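(* Let $\gamma_0>1$ be such that the Delaunay torus $\mathbb T_{\mathrm D,c}$ exists for all $1<c<\gamma_0$. Then the family of Delaunay spheres $\mathbb S_{\mathrm D,c}$ (the rotationally symmetric $C^{1,1}$ surfaces of sphere type in $\mathbb R^3$ defined in the context) satisfies $$\mathcal W(\mathbb S_{\mathrm D,c})=4\pi+\frac{\mathcal W(\mathbb T_{\mathrm D,c})}{2}\qquad\text{for all }1<c<\gamma_0$$ as well as $$\lim_{c\to1+}\operatorname{iso}(\mathbb S_{\mathrm D,c})=\infty .$$
   Context: **Functionals.** For an immersed oriented closed surface $f:\Sigma\to\mathbb R^3$ of class at least $C^{1,1}$, with Gauss map $n:\Sigma\to\mathbb S^2$ and area measure $\mu$ of the pulled-back Euclidean metric, let $H$ be the arithmetic mean of the two principal curvatures (defined $\mu$-almost everywhere) and set $$\mathcal W(f)=\int_\Sigma H^2\,d\mu,\qquad \operatorname{area}(f)=\int_\Sigma 1\,d\mu,\qquad \operatorname{vol}(f)=\frac13\int_\Sigma n\cdot f\,d\mu,$$ $$\operatorname{iso}(f)=\frac{\operatorname{area}(f)}{\operatorname{vol}(f)^{2/3}}\ \text{ if }\operatorname{vol}(f)>0,\qquad \operatorname{iso}(f)=\infty\ \text{ if }\operatorname{vol}(f)\le 0.$$ For the surfaces below the orientation is chosen so that $\operatorname{vol}\ge 0$ (for an embedded surface: $n$ is the outward normal and $\operatorname{vol}$ is the enclosed volume). **Elliptic integrals.** For $0<k<1$, $K(k)=\int_0^{\pi/2}\frac{d\theta}{\sqrt{1-k^2\sin^2\theta}}$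 and $E(k)=\int_0^{\pi/2}\sqrt{1-k^2\sin^2\theta}\,d\theta$. **Delaunay tori $\mathbb T_{\mathrm D,c}$.** Let $c>1$. Suppose $a>y>0$ solve the system $$4aE\Bigl(\frac ya\Bigr)=4c\Bigl[E\Bigl(\frac1c\Bigr)-\Bigl(1-\frac1{c^2}\Bigr)K\Bigl(\frac1c\Bigr)\Bigr],\qquad a-y=c-1,$$ and let $L$ denote the common value of both sides of the first equation. (For given $c$ there is at most one such solution, since $y\mapsto (y+c-1)E\bigl(\tfrac{y}{y+c-1}\bigr)$ is strictly increasing; we say that $\mathbb T_{\mathrm D,c}$ exists if there is a solution.) Define two plane curves, where the first coordinate is the distance to the axis of rotation and the second is the position along the axis: * *Unduloid arc* (one period): for $0\le t\le2\pi$, $$f_U(t)=\sqrt{a^2-y^2}\,\frac{a-y\cos t}{\sqrt{a^2-y^2\cos^2t}},\qquad g_U(t)=\int_0^t\sqrt{a^2-y^2\cos^2x}\,dx-y\sin t\,\frac{a-y\cos t}{\sqrt{a^2-y^2\cos^2t}}.$$ It runs from $(a-y,0)$ through its maximum $(a+y,L/2)$ at $t=\pi$ to $(a-y,L)$. * *Nodoid arc* (one period, translated by $L$): for $0\le s\le2\pi$, $$f_N(s)=\sqrt{c^2-\sin^2s}-\cos s,\qquad g_N(s)=L+\int_0^s\Bigl(\cos x-\frac{\cos^2x}{\sqrt{c^2-\sin^2x}}\Bigr)dx.$$ It runs from $(c-1,L)$ through its maximum $(c+1,L/2)$ at $s=\pi$ to $(c-1,0)$. The concatenation of the two arcs is a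 closed $C^{1,1}$-regular curve in $\{(f,g)\in\mathbb R^2: f>0\}$. $\mathbb T_{\mathrm D,c}$ is the surface of revolution in $\mathbb R^3$ obtained from this profile curve via $(f,g)\mapsto(f\cos\theta,f\sin\theta,g)$, $\theta\in[0,2\pi]$. **Delaunay spheres $\mathbb S_{\mathrm D,c}$.** Take the half of the profile curve of $\mathbb T_{\mathrm D,c}$ consisting of the unduloid half-arc $0\le t\le\pi$ (from $(a-y,0)$ to $(a+y,L/2)$) and the nodoid half-arc $\pi\le s\le2\pi$ (from $(c+1,L/2)$ to $(c-1,0)=(a-y,0)$). Attach to its two end points the two concentric quarter circles centred at $(0,L/2)$ and lying in $\{f\ge0,\ g\ge L/2\}$: the one of radius $a+y$ from $(a+y,L/2)$ to $(0,L/2+a+y)$, and the one of radius $c+1$ from $(c+1,L/2)$ to $(0,L/2+c+1)$. The resulting curve is $C^{1,1}$-regular and meets the axis $\{f=0\}$ perpendicularly at both ends; $\mathbb S_{\mathrm D,c}$ is its surface of revolution, which is a $C^{1,1}$ surface of sphere type. *)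

theory Defs
  imports "HOL-Analysis.Analysis"
begin

section \<open>Parametrized oriented surfaces in 3-space\<close>

text \<open>
  A surface is given by a parametrization that covers it once up to a set of measure zero, which
  is all that the functionals below depend on; \<open>orientation\<close> is \<open>1\<close> or \<open>-1\<close> and selects one of the
  two unit normal fields. Wherever a derivative does not exist, the values below are arbitrary;
  for a piecewise smooth parametrization this happens only on a null set.
\<close>

record surface =
  param_dom :: "(real \<times> real) set"
  param :: "real \<times> real \<Rightarrow> real^3"
  orientation :: real

abbreviation differential :: "(real \<times> real \<Rightarrow> real^3) \<Rightarrow> real \<times> real \<Rightarrow> real \<times> real \<Rightarrow> real^3"
  where "differential X p \<equiv> frechet_derivative X (at p)"

definition param_normal :: "(real \<times> real \<Rightarrow> real^3) \<Rightarrow> real \<times> real \<Rightarrow> real^3"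
  where "param_normal X p = cross3 (differential X p (1, 0)) (differential X p (0, 1))"

definition gauss_map :: "surface \<Rightarrow> real \<times> real \<Rightarrow> real^3"
  where "gauss_map S p = orientation S *\<^sub>R sgn (param_normal (param S) p)"

definition area_measure :: "surface \<Rightarrow> (real \<times> real) measure"
  where "area_measure S =
    density (lebesgue_on (param_dom S)) (\<lambda>p. ennreal (norm (param_normal (param S) p)))"

text \<open>
  The principal curvatures are the two eigenvalues, counted with multiplicity, of the shape
  operator \<open>A\<close> given by \<open>dn = df \<circ> A\<close>, which is diagonalizable. With this sign a round sphere of
  radius \<open>r\<close> has principal curvatures \<open>1/r\<close> for its outward normal.
\<close>

definition principal_curvatures :: "surface \<Rightarrow> real \<times> real \<Rightarrow> real \<Rightarrow> real \<Rightarrow> bool"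
  where "principal_curvatures S p k1 k2 \<longleftrightarrow>
    (\<exists>v w. v \<noteq> w \<and> independent {v, w} \<and>
      differential (gauss_map S) p v = k1 *\<^sub>R differential (param S) p v \<and>
      differential (gauss_map S) p w = k2 *\<^sub>R differential (param S) p w)"

definition mean_curvature :: "surface \<Rightarrow> real \<times> real \<Rightarrow> real"
  where "mean_curvature S p = (THE h. \<exists>k1 k2. principal_curvatures S p k1 k2 \<and> h = (k1 + k2) / 2)"

definition willmore_energy :: "surface \<Rightarrow> real"
  where "willmore_energy S = (\<integral>p. (mean_curvature S p)\<^sup>2 \<partial>area_measure S)"

definition surface_area :: "surface \<Rightarrow> real"
  where "surface_area S = (\<integral>p. 1 \<partial>area_measure S)"

definition surface_vol :: "surface \<Rightarrow> real"
  where "surface_vol S = 1 / 3 * (\<integral>p. gauss_map S p \<bullet> param S p \<partial>area_measure S)"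

definition isoperimetric_ratio :: "surface \<Rightarrow> ereal"
  where "isoperimetric_ratio S =
    (if surface_vol S > 0 then ereal (surface_area S / surface_vol S powr (2 / 3)) else \<infinity>)"

definition orient_nonneg_vol :: "surface \<Rightarrow> surface"
  where "orient_nonneg_vol S =
    (if surface_vol S \<ge> 0 then S else S\<lparr>orientation := - orientation S\<rparr>)"

text \<open>
  A profile curve \<open>\<gamma> = (f, g)\<close> is parametrized over \<open>[0,1]\<close>, as for library paths; \<open>f\<close> is the
  distance to the axis of rotation and \<open>g\<close> the position along it.
\<close>

definition surface_of_revolution :: "(real \<Rightarrow> real \<times> real) \<Rightarrow> surface"
  where "surface_of_revolution \<gamma> = orient_nonneg_vol
    \<lparr>param_dom = {0..1} \<times> {0..2 * pi},
     param = (\<lambda>(u, \<theta>). vector [fst (\<gamma> u) * cos \<theta>, fst (\<gamma> u) * sin \<theta>, snd (\<gamma> u)]),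
     orientation = 1\<rparr>"


section \<open>Complete elliptic integrals in terms of the modulus\<close>

definition elliptic_K :: "real \<Rightarrow> real"
  where "elliptic_K k = integral {0..pi / 2} (\<lambda>\<theta>. 1 / sqrt (1 - k\<^sup>2 * (sin \<theta>)\<^sup>2))"

definition elliptic_E :: "real \<Rightarrow> real"
  where "elliptic_E k = integral {0..pi / 2} (\<lambda>\<theta>. sqrt (1 - k\<^sup>2 * (sin \<theta>)\<^sup>2))"


section \<open>Delaunay tori and Delaunay spheres\<close>

definition delaunay_system :: "real \<Rightarrow> real \<Rightarrow> real \<Rightarrow> bool"
  where "delaunay_system c a y \<longleftrightarrow> a > y \<and> y > 0 \<and>
    4 * a * elliptic_E (y / a) =
      4 * c * (elliptic_E (1 / c) - (1 - 1 / c\<^sup>2) * elliptic_K (1 / c)) \<and>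
    a - y = c - 1"

definition delaunay_torus_exists :: "real \<Rightarrow> bool"
  where "delaunay_torus_exists c \<longleftrightarrow> c > 1 \<and> (\<exists>a y. delaunay_system c a y)"

text \<open>For each \<open>c > 1\<close> the system has at most one solution, so the choice below is immaterial.\<close>

definition delaunay_a :: "real \<Rightarrow> real"
  where "delaunay_a c = fst (SOME (a, y). delaunay_system c a y)"

definition delaunay_y :: "real \<Rightarrow> real"
  where "delaunay_y c = snd (SOME (a, y). delaunay_system c a y)"

definition delaunay_L :: "real \<Rightarrow> real"
  where "delaunay_L c = 4 * delaunay_a c * elliptic_E (delaunay_y c / delaunay_a c)"

definition unduloid :: "real \<Rightarrow> real \<Rightarrow> real \<Rightarrow> real \<times> real"
  where "unduloid a y t =
    (sqrt (a\<^sup>2 - y\<^sup>2) * ((a - y * cos t) / sqrt (a\<^sup>2 - y\<^sup>2 * (cos t)\<^sup>2)),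
     integral {0..t} (\<lambda>x. sqrt (a\<^sup>2 - y\<^sup>2 * (cos x)\<^sup>2)) -
       y * sin t * ((a - y * cos t) / sqrt (a\<^sup>2 - y\<^sup>2 * (cos t)\<^sup>2)))"

definition nodoid :: "real \<Rightarrow> real \<Rightarrow> real \<Rightarrow> real \<times> real"
  where "nodoid c L s =
    (sqrt (c\<^sup>2 - (sin s)\<^sup>2) - cos s,
     L + integral {0..s} (\<lambda>x. cos x - (cos x)\<^sup>2 / sqrt (c\<^sup>2 - (sin x)\<^sup>2)))"

text \<open>The circle of radius \<open>r\<close> about the point \<open>(0, h)\<close> of the axis.\<close>

definition axis_circle :: "real \<Rightarrow> real \<Rightarrow> real \<Rightarrow> real \<times> real"
  where "axis_circle h r t = (r * cos t, h + r * sin t)"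

definition delaunay_torus_profile :: "real \<Rightarrow> real \<Rightarrow> real \<times> real"
  where "delaunay_torus_profile c =
    subpath 0 (2 * pi) (unduloid (delaunay_a c) (delaunay_y c)) +++
    subpath 0 (2 * pi) (nodoid c (delaunay_L c))"

definition delaunay_torus :: "real \<Rightarrow> surface"
  where "delaunay_torus c = surface_of_revolution (delaunay_torus_profile c)"

text \<open>
  The curve is traversed from one pole to the other: quarter circle of radius \<open>c + 1\<close>, nodoid
  half-arc, unduloid half-arc, quarter circle of radius \<open>a + y\<close>.
\<close>

definition delaunay_sphere_profile :: "real \<Rightarrow> real \<Rightarrow> real \<times> real"
  where "delaunay_sphere_profile c =
    subpath (pi / 2) 0 (axis_circle (delaunay_L c / 2) (c + 1)) +++
    subpath pi (2 * pi) (nodoid c (delaunay_L c)) +++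
    subpath 0 pi (unduloid (delaunay_a c) (delaunay_y c)) +++
    subpath 0 (pi / 2) (axis_circle (delaunay_L c / 2) (delaunay_a c + delaunay_y c))"

definition delaunay_sphere :: "real \<Rightarrow> surface"
  where "delaunay_sphere c = surface_of_revolution (delaunay_sphere_profile c)"

end

(*
  Along a profile curve whose unit tangent (p, r) turns at rate \<omega> and whose speed is q, the surface of
  revolution has principal curvatures \<omega> / q and - r / f, up to the common sign of the orientation. On the
  nodoid and on the unduloid their mean is constant, so the Willmore integrand is a multiple of the
  area density; that density is invariant under reflecting a period, so half of the profile carries
  half of the energy of the torus. Each quarter circle adds the energy 2 pi of a hemisphere.

  As c tends to 1, all four arcs of the sphere's profile tend to quarters of one circle of radius 2:
  the spheres degenerate to a round sphere covered twice with opposite orientations. So the enclosed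
  volume tends to 0, while the area is at least that of the cap of radius c + 1.
*)
theory Submission
  imports Defs
begin

text \<open>The obstacle is that \<open>a\<close> and \<open>y\<close> are given only by an elliptic
  equation, and that the data degenerate as c tends to 1: K(1/c) diverges and the waist a^2 - y^2
  vanishes. No asymptotic expansion is made. Every quantity is brought into the form of an integral
  over a fixed interval whose integrand extends continuously to the limit parameters, so that its
  limit is its value there. For L this needs E and K merged into one bounded quotient; for the
  unduloid it needs another parameter than the given angle. The limit of \<open>a\<close> follows
  from squeezing the integrand of E between a cos and a cos + b, where b^2 = a^2 - y^2 = (a + y)(c -
  1). The support function contains the heights of the arcs, which are integrals themselves. An
  integration by parts trades them for slices f^2 g' and for heights at junctions only. The
  orientation depends on the sign of a volume that is known only afterwards. Hence everything is
  computed for both signs, and only the absolute value enters. Whether the volume vanishes for some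
  c need not be decided, since the ratio is infinite in that case.\<close>

section \<open>Geometry of surfaces of revolution\<close>

text \<open>The surface before \<open>orient_nonneg_vol\<close> acts, with the sign of the normal
  left free.\<close>

definition revolution :: "(real \<Rightarrow> real \<times> real) \<Rightarrow> real \<Rightarrow> surface"
  where "revolution \<gamma> \<epsilon> =
    \<lparr>param_dom = {0..1} \<times> {0..2 * pi},
     param = (\<lambda>(u, \<theta>). vector [fst (\<gamma> u) * cos \<theta>, fst (\<gamma> u) * sin \<theta>, snd (\<gamma> u)]),
     orientation = \<epsilon>\<rparr>"

text \<open>The frame is supplied with each arc instead of being derived from
  \<open>\<gamma>\<close>, which avoids normalizing and differentiating twice. The convention for
  \<open>\<omega>\<close> is that of a tangent (sin x, cos x) with x' = \<open>\<omega>\<close>. The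
  set \<open>T\<close> is open and keeps away from poles and junctions, where the geometry breaks
  down.\<close>

definition moving_frame ::
    "(real \<Rightarrow> real \<times> real) \<Rightarrow> (real \<Rightarrow> real) \<Rightarrow> (real \<Rightarrow> real) \<Rightarrow> (real \<Rightarrow> real) \<Rightarrow> (real \<Rightarrow> real) \<Rightarrow>
      real set \<Rightarrow> bool"
  where "moving_frame \<gamma> q p r \<omega> T \<longleftrightarrow> open T \<and>
    (\<forall>t\<in>T. 0 < fst (\<gamma> t) \<and> 0 < q t \<and>
      ((\<lambda>t. fst (\<gamma> t)) has_real_derivative q t * p t) (at t) \<and>
      ((\<lambda>t. snd (\<gamma> t)) has_real_derivative q t * r t) (at t) \<and>
      (p t)\<^sup>2 + (r t)\<^sup>2 = 1 \<and>
      (p has_real_derivative \<omega> t * r t) (at t) \<and>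
      (r has_real_derivative - \<omega> t * p t) (at t))"

lemma moving_frameD:
  assumes "moving_frame \<gamma> q p r \<omega> T"
  shows "open T"
    and "t \<in> T \<Longrightarrow> 0 < fst (\<gamma> t)"
    and "t \<in> T \<Longrightarrow> 0 < q t"
    and "t \<in> T \<Longrightarrow> ((\<lambda>t. fst (\<gamma> t)) has_real_derivative q t * p t) (at t)"
    and "t \<in> T \<Longrightarrow> ((\<lambda>t. snd (\<gamma> t)) has_real_derivative q t * r t) (at t)"
    and "t \<in> T \<Longrightarrow> (p t)\<^sup>2 + (r t)\<^sup>2 = 1"
    and "t \<in> T \<Longrightarrow> (p has_real_derivative \<omega> t * r t) (at t)"
    and "t \<in> T \<Longrightarrow> (r has_real_derivative - \<omega> t * p t) (at t)"
  using assms unfolding moving_frame_def by blast+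

text \<open>Serves twice: for the parametrization with (F, G) = (f, g), and for the Gauss map, which
  has the same rotational form.\<close>

lemma has_derivative_rotated:
  fixes F G :: "real \<Rightarrow> real"
  assumes "(F has_real_derivative F') (at u)" "(G has_real_derivative G') (at u)"
  shows "((\<lambda>(u, \<theta>). vector [F u * cos \<theta>, F u * sin \<theta>, G u] :: real^3) has_derivative
      (\<lambda>v. fst v *\<^sub>R vector [F' * cos \<theta>, F' * sin \<theta>, G'] +
            (snd v * F u) *\<^sub>R vector [- sin \<theta>, cos \<theta>, 0])) (at (u, \<theta>))"
proof -
  have F: "((\<lambda>x. F (fst x)) has_derivative (\<lambda>x. fst x * F')) (at (u, \<theta>))"
    by (rule DERIV_compose_FDERIV) (use assms(1) in \<open>auto intro!: derivative_intros\<close>)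
  have G: "((\<lambda>x. G (fst x)) has_derivative (\<lambda>x. fst x * G')) (at (u, \<theta>))"
    by (rule DERIV_compose_FDERIV) (use assms(2) in \<open>auto intro!: derivative_intros\<close>)
  show ?thesis
    unfolding case_prod_unfold
    apply (subst has_derivative_componentwise_within)
    apply (auto simp: Basis_vec_def inner_axis axis_eq_axis)
    subgoal for i
      using exhaust_3[of i]
    proof (elim disjE)
      assume "i = 3"
      then show ?thesis using G by simp
    qed (auto intro!: derivative_eq_intros F simp: algebra_simps)
    done
qed

lemma independent_pair_det:
  fixes v w :: "real \<times> real"
  assumes "independent {v, w}" "v \<noteq> w"
  shows "fst v * snd w - snd v * fst w \<noteq> 0"
proof
  assume det: "fst v * snd w - snd v * fst w = 0"
  have "v \<noteq> 0" using assms dependent_zero by blast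
  have "w \<noteq> 0" using assms dependent_zero by blast
  have "w \<in> span {v}"
  proof (cases "fst v = 0")
    case True
    then have "snd v \<noteq> 0" using \<open>v \<noteq> 0\<close> by (simp add: prod_eq_iff)
    then have "w = (snd w / snd v) *\<^sub>R v" using det True by (auto simp: prod_eq_iff)
    then show ?thesis by (metis span_base span_scale singletonI)
  next
    case False
    then have "w = (fst w / fst v) *\<^sub>R v" using det by (auto simp: prod_eq_iff field_simps)
    then show ?thesis by (metis span_base span_scale singletonI)
  qed
  moreover have "{v, w} - {w} = {v}" using assms(2) by auto
  ultimately show False using assms(1) unfolding dependent_def by auto
qed

lemma independent_coordinate_pair: "independent {(1, 0), (0, 1) :: real \<times> real}"
  by (rule independent_mono[OF independent_Basis]) (auto simp: Basis_prod_def)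

text \<open>The trace of the shape operator does not depend on the eigenbasis.\<close>

lemma mean_curvature_eqI:
  assumes x: "\<And>v. differential (param S) z v = fst v *\<^sub>R x1 + snd v *\<^sub>R x2"
    and n: "\<And>v. differential (gauss_map S) z v = (k1 * fst v) *\<^sub>R x1 + (k2 * snd v) *\<^sub>R x2"
    and orth: "x1 \<bullet> x2 = 0" "x1 \<noteq> 0" "x2 \<noteq> 0"
  shows "mean_curvature S z = (k1 + k2) / 2"
  unfolding mean_curvature_def
proof (rule the_equality)
  show "\<exists>l1 l2. principal_curvatures S z l1 l2 \<and> (k1 + k2) / 2 = (l1 + l2) / 2"
  proof (intro exI conjI)
    show "principal_curvatures S z k1 k2"
      unfolding principal_curvatures_def using independent_coordinate_pair
      by (intro exI[of _ "(1, 0)"] exI[of _ "(0, 1)"]) (auto simp: x n)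
  qed simp
next
  have eig: "(k1 - k) * fst v = 0 \<and> (k2 - k) * snd v = 0"
    if "differential (gauss_map S) z v = k *\<^sub>R differential (param S) z v" for k v
  proof -
    have *: "((k1 - k) * fst v) *\<^sub>R x1 + ((k2 - k) * snd v) *\<^sub>R x2 = 0"
      using that by (simp add: x n algebra_simps)
    have "((k1 - k) * fst v) * (x1 \<bullet> x1) = 0"
      using arg_cong[OF *, of "\<lambda>w. x1 \<bullet> w"] orth by (simp add: inner_add_right)
    moreover have "((k2 - k) * snd v) * (x2 \<bullet> x2) = 0"
      using arg_cong[OF *, of "\<lambda>w. x2 \<bullet> w"] orth by (simp add: inner_add_right inner_commute)
    ultimately show ?thesis using orth by auto
  qed
  fix h
  assume "\<exists>l1 l2. principal_curvatures S z l1 l2 \<and> h = (l1 + l2) / 2"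
  then obtain l1 l2 v w where h: "h = (l1 + l2) / 2" and vw: "v \<noteq> w" "independent {v, w}"
    and "differential (gauss_map S) z v = l1 *\<^sub>R differential (param S) z v"
    and "differential (gauss_map S) z w = l2 *\<^sub>R differential (param S) z w"
    unfolding principal_curvatures_def by blast
  then have e: "(k1 - l1) * fst v = 0" "(k2 - l1) * snd v = 0"
      "(k1 - l2) * fst w = 0" "(k2 - l2) * snd w = 0"
    using eig by blast+
  have "fst v * snd w - snd v * fst w \<noteq> 0"
    by (rule independent_pair_det[OF vw(2,1)])
  \<comment> \<open>By \<open>eig\<close>, a nonzero coordinate of an eigenvector fixes its
    eigenvalue. A nonzero determinant thus forces one eigenvalue to be \<open>k1\<close> and the
    other \<open>k2\<close>, in one of the two orders.\<close>
  then have "(fst v \<noteq> 0 \<and> snd w \<noteq> 0) \<or> (snd v \<noteq> 0 \<and> fst w \<noteq> 0)"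
    by auto
  then have "l1 + l2 = k1 + k2"
    using e by auto
  then show "h = (k1 + k2) / 2" using h by simp
qed

lemma revolution_geometry:
  assumes "moving_frame \<gamma> q p r \<omega> T" and t: "t \<in> T" and eps: "\<epsilon> = 1 \<or> \<epsilon> = -1"
  shows "norm (param_normal (param (revolution \<gamma> \<epsilon>)) (t, \<theta>)) = fst (\<gamma> t) * q t"
    and "gauss_map (revolution \<gamma> \<epsilon>) (t, \<theta>) \<bullet> param (revolution \<gamma> \<epsilon>) (t, \<theta>) =
      \<epsilon> * (p t * snd (\<gamma> t) - r t * fst (\<gamma> t))"
    and "(mean_curvature (revolution \<gamma> \<epsilon>) (t, \<theta>))\<^sup>2 = (\<omega> t / q t - r t / fst (\<gamma> t))\<^sup>2 / 4"
proof -
  note fr = moving_frameD[OF assms(1)]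
  let ?S = "revolution \<gamma> \<epsilon>"
  \<comment> \<open>Orthonormal frame on \<open>T\<close>: tangent of the meridian, tangent of the
    parallel, and their cross product.\<close>
  let ?e1 = "\<lambda>t \<theta>. vector [p t * cos \<theta>, p t * sin \<theta>, r t] :: real^3"
  let ?e2 = "\<lambda>\<theta>. vector [- sin \<theta>, cos \<theta>, 0] :: real^3"
  let ?e3 = "\<lambda>t \<theta>. vector [- r t * cos \<theta>, - r t * sin \<theta>, p t] :: real^3"
  \<comment> \<open>The identity sin^2 + cos^2 = 1, shaped for the right-nested products that
    \<open>algebra_simps\<close> leaves.\<close>
  have ss: "sin \<theta> * (sin \<theta> * x) = x - cos \<theta> * (cos \<theta> * x)" for \<theta> x :: real
  proof -
    have "sin \<theta> * (sin \<theta> * x) = (sin \<theta>)\<^sup>2 * x"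
      by (simp add: power2_eq_square)
    also have "\<dots> = x - cos \<theta> * (cos \<theta> * x)"
      unfolding sin_squared_eq by (simp add: power2_eq_square algebra_simps)
    finally show ?thesis .
  qed
  have vsc: "c *\<^sub>R (vector [x, y, z] :: real^3) = vector [c * x, c * y, c * z]" for c x y z
    by (simp add: vec_eq_iff forall_3)
  have dX: "differential (param ?S) (t, \<theta>) = (\<lambda>v. fst v *\<^sub>R (q t *\<^sub>R ?e1 t \<theta>) + snd v *\<^sub>R (fst (\<gamma> t) *\<^sub>R ?e2 \<theta>))"
    if "t \<in> T" for t \<theta>
    using frechet_derivative_at[OF has_derivative_rotated[OF fr(4,5), OF that that, of \<theta>]]
    by (simp add: revolution_def vsc mult.assoc)
  have N: "param_normal (param ?S) (t, \<theta>) = (fst (\<gamma> t) * q t) *\<^sub>R ?e3 t \<theta>" if "t \<in> T" for t \<theta>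
    by (simp add: param_normal_def dX[OF that] cross3_def vec_eq_iff forall_3 algebra_simps ss)
  have e3: "norm (?e3 t \<theta>) = 1" if "t \<in> T" for t \<theta>
  proof -
    have "(r t * cos \<theta>)\<^sup>2 + (r t * sin \<theta>)\<^sup>2 = (r t)\<^sup>2"
      unfolding power_mult_distrib distrib_left[symmetric] by simp
    then show ?thesis
      using fr(6)[OF that] by (simp add: norm_eq_sqrt_inner inner_vec_def sum_3 power2_eq_square)
  qed
  have pos: "fst (\<gamma> t) * q t > 0" if "t \<in> T" for t
    using fr that by simp
  \<comment> \<open>Needed at all points of \<open>T\<close>, not only at the given one, because the
    Gauss map is differentiated below.\<close>
  have gm: "gauss_map ?S (t, \<theta>) = vector [(- \<epsilon> * r t) * cos \<theta>, (- \<epsilon> * r t) * sin \<theta>, \<epsilon> * p t]"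
    if "t \<in> T" for t \<theta>
  proof -
    have "sgn (param_normal (param ?S) (t, \<theta>)) = ?e3 t \<theta>"
    proof -
      have "sgn (?e3 t \<theta>) = ?e3 t \<theta>"
        using e3[OF that, of \<theta>] by (simp add: sgn_div_norm)
      then show ?thesis
        unfolding N[OF that] sgn_scaleR sgn_pos[OF pos[OF that]] by simp
    qed
    then show ?thesis by (simp add: gauss_map_def revolution_def vsc mult.assoc)
  qed
  show "norm (param_normal (param ?S) (t, \<theta>)) = fst (\<gamma> t) * q t"
    using fr(2,3)[OF t] e3[OF t] by (simp add: N[OF t] abs_mult)
  show "gauss_map ?S (t, \<theta>) \<bullet> param ?S (t, \<theta>) = \<epsilon> * (p t * snd (\<gamma> t) - r t * fst (\<gamma> t))"
  proof -
    have "param ?S (t, \<theta>) = vector [fst (\<gamma> t) * cos \<theta>, fst (\<gamma> t) * sin \<theta>, snd (\<gamma> t)]"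
      by (simp add: revolution_def)
    then show ?thesis
      unfolding gm[OF t] by (simp add: inner_vec_def sum_3 algebra_simps ss)
  qed
  \<comment> \<open>The Gauss map rotates the curve (-\<open>\<epsilon>\<close> r,
    \<open>\<epsilon>\<close> p), and the frame equations give its derivative. The coordinate
    directions therefore stay eigendirections.\<close>
  have "((\<lambda>(u, \<theta>). vector [(- \<epsilon> * r u) * cos \<theta>, (- \<epsilon> * r u) * sin \<theta>, \<epsilon> * p u] :: real^3) has_derivative
      (\<lambda>v. fst v *\<^sub>R vector [(\<epsilon> * \<omega> t * p t) * cos \<theta>, (\<epsilon> * \<omega> t * p t) * sin \<theta>, \<epsilon> * \<omega> t * r t] +
            (snd v * (- \<epsilon> * r t)) *\<^sub>R vector [- sin \<theta>, cos \<theta>, 0])) (at (t, \<theta>))"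
    by (rule has_derivative_rotated) (auto intro!: derivative_eq_intros fr t)
  then have "(gauss_map ?S has_derivative
      (\<lambda>v. fst v *\<^sub>R vector [(\<epsilon> * \<omega> t * p t) * cos \<theta>, (\<epsilon> * \<omega> t * p t) * sin \<theta>, \<epsilon> * \<omega> t * r t] +
            (snd v * (- \<epsilon> * r t)) *\<^sub>R vector [- sin \<theta>, cos \<theta>, 0])) (at (t, \<theta>))"
    by (rule has_derivative_transform_within_open[where s = "T \<times> UNIV"])
      (use t fr(1) gm in \<open>auto intro: open_Times\<close>)
  from frechet_derivative_at[OF this, symmetric]
  have dn: "differential (gauss_map ?S) (t, \<theta>) v =
      ((\<epsilon> * \<omega> t / q t) * fst v) *\<^sub>R (q t *\<^sub>R ?e1 t \<theta>) +
      ((- \<epsilon> * r t / fst (\<gamma> t)) * snd v) *\<^sub>R (fst (\<gamma> t) *\<^sub>R ?e2 \<theta>)" for v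
    using fr(2,3)[OF t] by (simp add: vsc mult_ac)
  have ne: "?e1 t \<theta> \<noteq> 0" "?e2 \<theta> \<noteq> 0"
  proof -
    show "?e2 \<theta> \<noteq> 0"
      using sin_zero_abs_cos_one[of \<theta>] by (auto simp: vec_eq_iff forall_3)
    then have "sin \<theta> \<noteq> 0 \<or> cos \<theta> \<noteq> 0" 
      by (auto simp: vec_eq_iff forall_3)
    then show "?e1 t \<theta> \<noteq> 0"
      using fr(6)[OF t] by (auto simp: vec_eq_iff forall_3)
  qed
  have "mean_curvature ?S (t, \<theta>) = (\<epsilon> * \<omega> t / q t + - \<epsilon> * r t / fst (\<gamma> t)) / 2"
  proof (rule mean_curvature_eqI[OF _ dn])
    show "(q t *\<^sub>R ?e1 t \<theta>) \<bullet> (fst (\<gamma> t) *\<^sub>R ?e2 \<theta>) = 0"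
      by (simp add: inner_vec_def sum_3)
  qed (use fr(2,3)[OF t] ne in \<open>auto simp: dX[OF t]\<close>)
  also have "\<dots> = \<epsilon> * (\<omega> t / q t - r t / fst (\<gamma> t)) / 2"
    by (simp add: algebra_simps)
  finally have mc: "mean_curvature ?S (t, \<theta>) = \<epsilon> * (\<omega> t / q t - r t / fst (\<gamma> t)) / 2" .
  show "(mean_curvature ?S (t, \<theta>))\<^sup>2 = (\<omega> t / q t - r t / fst (\<gamma> t))\<^sup>2 / 4"
    unfolding mc using eps by (auto simp: power_divide power2_commute)
qed

section \<open>Integration over bands\<close>

text \<open>Absolute integrability makes the gauge integral, in which bands are glued and
  substitutions done, agree with the Lebesgue integral of the functionals.\<close>

definition has_band_integral :: "(real \<times> real \<Rightarrow> real) \<Rightarrow> real \<Rightarrow> real \<Rightarrow> real \<Rightarrow> bool"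
  where "has_band_integral \<phi> u0 u1 I \<longleftrightarrow>
    \<phi> absolutely_integrable_on ({u0..u1} \<times> {0..2 * pi}) \<and>
    integral ({u0..u1} \<times> {0..2 * pi}) \<phi> = I"

lemma negligible_vertical_line: "negligible ({u} \<times> (T :: real set))" for u :: real
proof -
  have "negligible {x :: real \<times> real. x \<bullet> (1, 0) = u}"
    by (rule negligible_standard_hyperplane) (auto simp: Basis_prod_def)
  then show ?thesis
    by (rule negligible_subset) auto
qed

text \<open>The edges of a band are null sets, so the arbitrary values of the geometry at junctions
  and poles do no harm; independence of the angle yields the factor 2 pi.\<close>

lemma has_band_integral_continuous:
  assumes le: "u0 \<le> u1" and G: "continuous_on {u0..u1} G"
    and eq: "\<And>u \<theta>. u0 < u \<Longrightarrow> u < u1 \<Longrightarrow> \<phi> (u, \<theta>) = G u"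
  shows "has_band_integral \<phi> u0 u1 (2 * pi * integral {u0..u1} G)"
proof -
  have box: "{u0..u1} \<times> {0..2 * pi} = cbox (u0, 0) (u1, 2 * pi)"
    by (auto simp: cbox_Pair_eq)
  let ?N = "{u0} \<times> (UNIV :: real set) \<union> {u1} \<times> UNIV"
  have N: "negligible ?N"
    by (intro negligible_Un negligible_vertical_line)
  have cont: "continuous_on (cbox (u0, 0) (u1, 2 * pi)) (\<lambda>z. G (fst z))"
    by (rule continuous_on_compose2[OF G]) (auto simp: cbox_Pair_eq intro!: continuous_intros)
  have spike: "\<phi> z = G (fst z)" if "z \<in> cbox (u0, 0) (u1, 2 * pi) - ?N" for z
    using that eq[of "fst z" "snd z"] by (cases z) (auto simp: cbox_Pair_eq)
  have "\<phi> absolutely_integrable_on cbox (u0, 0) (u1, 2 * pi)"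
    by (rule absolutely_integrable_spike[OF absolutely_integrable_continuous[OF cont] N spike])
  moreover have "integral (cbox (u0, 0) (u1, 2 * pi)) \<phi> = integral (cbox (u0, 0) (u1, 2 * pi)) (\<lambda>z. G (fst z))"
    by (rule integral_spike[OF N]) (simp add: spike)
  moreover have "\<dots> = 2 * pi * integral {u0..u1} G"
    by (subst integral_prod_continuous[OF cont]) simp
  ultimately show ?thesis
    unfolding has_band_integral_def box by simp
qed

lemma has_band_integral_combine:
  assumes "has_band_integral \<phi> u0 u1 I" "has_band_integral \<phi> u1 u2 J" "u0 \<le> u1" "u1 \<le> u2"
  shows "has_band_integral \<phi> u0 u2 (I + J)"
proof -
  let ?B = "\<lambda>a b. {a..b} \<times> {0..2 * pi}"
  have un: "?B u0 u2 = ?B u0 u1 \<union> ?B u1 u2"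
    using assms(3,4) by auto
  have "?B u0 u1 \<inter> ?B u1 u2 \<subseteq> {u1} \<times> UNIV"
    by auto
  then have neg: "negligible (?B u0 u1 \<inter> ?B u1 u2)"
    using negligible_vertical_line negligible_subset by blast
  have ai: "\<phi> absolutely_integrable_on ?B u0 u1" "\<phi> absolutely_integrable_on ?B u1 u2"
    and I: "integral (?B u0 u1) \<phi> = I" "integral (?B u1 u2) \<phi> = J"
    using assms(1,2) by (auto simp: has_band_integral_def)
  then have "(\<phi> has_integral I) (?B u0 u1)" "(\<phi> has_integral J) (?B u1 u2)"
    by (auto simp: has_integral_iff absolutely_integrable_on_def)
  from has_integral_Un[OF this neg] have "(\<phi> has_integral (I + J)) (?B u0 u2)"
    by (simp add: un)
  moreover have "\<phi> absolutely_integrable_on ?B u0 u2"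
    unfolding un by (rule absolutely_integrable_Un[OF ai])
  ultimately show ?thesis
    by (auto simp: has_band_integral_def integral_unique)
qed

text \<open>The first three integrals are the functionals against the area density, with
  \<open>V\<close> equal to three times the signed volume. The last two are there only to make the
  undensified integrands measurable, as is required for passing from \<open>area_measure\<close> to
  Lebesgue measure.\<close>

definition has_functionals_on ::
    "surface \<Rightarrow> real \<Rightarrow> real \<Rightarrow> real \<Rightarrow> real \<Rightarrow> real \<Rightarrow> bool"
  where "has_functionals_on S u0 u1 W A V \<longleftrightarrow>
    has_band_integral (\<lambda>z. norm (param_normal (param S) z) * (mean_curvature S z)\<^sup>2) u0 u1 W \<and>
    has_band_integral (\<lambda>z. norm (param_normal (param S) z)) u0 u1 A \<and>
    has_band_integral (\<lambda>z. norm (param_normal (param S) z) * (gauss_map S z \<bullet> param S z)) u0 u1 V \<and>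
    (\<exists>I. has_band_integral (\<lambda>z. (mean_curvature S z)\<^sup>2) u0 u1 I) \<and>
    (\<exists>I. has_band_integral (\<lambda>z. gauss_map S z \<bullet> param S z) u0 u1 I)"

lemma has_functionals_on_combine:
  assumes "has_functionals_on S u0 u1 W A V" "has_functionals_on S u1 u2 W' A' V'"
    "u0 \<le> u1" "u1 \<le> u2"
  shows "has_functionals_on S u0 u2 (W + W') (A + A') (V + V')"
  using assms unfolding has_functionals_on_def
  by (meson has_band_integral_combine)

lemma has_functionals_onD:
  assumes "has_functionals_on S 0 1 W A V" "param_dom S = {0..1} \<times> {0..2 * pi}"
  shows "willmore_energy S = W" "surface_area S = A" "surface_vol S = V / 3"
proof -
  let ?M = "lebesgue_on ({0..1} \<times> {0..2 * pi}) :: (real \<times> real) measure"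
  let ?N = "\<lambda>z. norm (param_normal (param S) z)"
  have "{0..1} \<times> {0..2 * pi} = (cbox (0, 0) (1, 2 * pi) :: (real \<times> real) set)"
    by (auto simp: cbox_Pair_eq)
  then have D: "{0..1} \<times> {0..2 * pi} \<in> sets (lebesgue :: (real \<times> real) measure)"
    by simp
  have meas: "\<phi> \<in> borel_measurable ?M" if "has_band_integral \<phi> 0 1 I" for \<phi> I
    using that D absolutely_integrable_imp_borel_measurable unfolding has_band_integral_def by blast
  have int: "integral\<^sup>L ?M \<phi> = I" if "has_band_integral \<phi> 0 1 I" for \<phi> I
    using that D unfolding has_band_integral_def
    by (subst lebesgue_integral_eq_integral) (auto simp: absolutely_integrable_on_def set_integrable_def integrable_restrict_space)
  have dens: "integral\<^sup>L (area_measure S) \<phi> = I"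
    if "has_band_integral (\<lambda>z. ?N z * \<phi> z) 0 1 I" "\<phi> \<in> borel_measurable ?M" for \<phi> I
  proof -
    have "?N \<in> borel_measurable ?M"
      using assms(1) meas unfolding has_functionals_on_def by blast
    then have "integral\<^sup>L (area_measure S) \<phi> = integral\<^sup>L ?M (\<lambda>z. ?N z *\<^sub>R \<phi> z)"
      unfolding area_measure_def assms(2) by (intro integral_density that) auto
    also have "\<dots> = I" using int[OF that(1)] by simp
    finally show ?thesis .
  qed
  show "willmore_energy S = W"
    using assms(1) unfolding willmore_energy_def has_functionals_on_def
    by (intro dens) (auto intro: meas)
  show "surface_area S = A"
    using assms(1) unfolding surface_area_def has_functionals_on_def
    by (intro dens) (auto intro: meas)
  show "surface_vol S = V / 3"
    using assms(1) dens[of "\<lambda>z. gauss_map S z \<bullet> param S z" V]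
    unfolding surface_vol_def has_functionals_on_def by (auto intro: meas)
qed

text \<open>Reversing the normal changes only the sign of \<open>V\<close>, and
  \<open>orient_nonneg_vol\<close> picks the sign that makes it nonnegative.\<close>

lemma surface_of_revolution_functionals:
  assumes "\<And>\<epsilon>. \<epsilon> = 1 \<or> \<epsilon> = -1 \<Longrightarrow> has_functionals_on (revolution \<gamma> \<epsilon>) 0 1 W A (\<epsilon> * V)"
  shows "willmore_energy (surface_of_revolution \<gamma>) = W"
    and "surface_area (surface_of_revolution \<gamma>) = A"
    and "surface_vol (surface_of_revolution \<gamma>) = \<bar>V\<bar> / 3"
proof -
  have *: "willmore_energy (revolution \<gamma> \<epsilon>) = W \<and> surface_area (revolution \<gamma> \<epsilon>) = A \<and>
      surface_vol (revolution \<gamma> \<epsilon>) = \<epsilon> * V / 3" if "\<epsilon> = 1 \<or> \<epsilon> = -1" for \<epsilon>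
    using has_functionals_onD[OF assms[OF that]] by (simp add: revolution_def)
  have "surface_of_revolution \<gamma> =
      (if V \<ge> 0 then revolution \<gamma> 1 else revolution \<gamma> (-1))"
    using *[of 1] by (simp add: surface_of_revolution_def orient_nonneg_vol_def revolution_def)
  then show "willmore_energy (surface_of_revolution \<gamma>) = W"
    and "surface_area (surface_of_revolution \<gamma>) = A"
    and "surface_vol (surface_of_revolution \<gamma>) = \<bar>V\<bar> / 3"
    using *[of 1] *[of "-1"] by (auto split: if_splits)
qed

text \<open>
  \<open>h\<close>, \<open>a\<close> and \<open>s\<close> are the squared mean curvature, the area density per unit angle and the support
  function of the surface of revolution, extended continuously to the end points of the arc.
\<close>

definition arc_densities ::
    "(real \<Rightarrow> real \<times> real) \<Rightarrow> real \<Rightarrow> real \<Rightarrow> (real \<Rightarrow> real) \<Rightarrow> (real \<Rightarrow> real) \<Rightarrow> (real \<Rightarrow> real) \<Rightarrow> bool"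
  where "arc_densities \<delta> t0 t1 h a s \<longleftrightarrow>
    continuous_on {t0..t1} h \<and> continuous_on {t0..t1} a \<and> continuous_on {t0..t1} s \<and>
    (\<exists>q p r \<omega>. moving_frame \<delta> q p r \<omega> {t0<..<t1} \<and>
      (\<forall>t\<in>{t0<..<t1}. h t = (\<omega> t / q t - r t / fst (\<delta> t))\<^sup>2 / 4 \<and>
        a t = fst (\<delta> t) * q t \<and>
        s t = p t * snd (\<delta> t) - r t * fst (\<delta> t)))"

text \<open>By the chain rule the speed, the turning rate and the area density scale with
  \<open>\<alpha>\<close>, while tangent, curvature and support are unchanged. A negative
  \<open>\<alpha>\<close> would reverse the normal.\<close>

lemma arc_densities_reparam:
  assumes "arc_densities \<delta> t0 t1 h a s" and \<alpha>: "\<alpha> > 0"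
    and t: "t0 = \<alpha> * u0 + \<beta>" "t1 = \<alpha> * u1 + \<beta>"
    and \<gamma>: "\<And>u. u0 < u \<Longrightarrow> u < u1 \<Longrightarrow> \<gamma> u = \<delta> (\<alpha> * u + \<beta>)"
  shows "arc_densities \<gamma> u0 u1 (\<lambda>u. h (\<alpha> * u + \<beta>)) (\<lambda>u. \<alpha> * a (\<alpha> * u + \<beta>)) (\<lambda>u. s (\<alpha> * u + \<beta>))"
proof -
  obtain q p r \<omega> where fr: "moving_frame \<delta> q p r \<omega> {t0<..<t1}"
    and eqs: "\<And>t. t \<in> {t0<..<t1} \<Longrightarrow> h t = (\<omega> t / q t - r t / fst (\<delta> t))\<^sup>2 / 4 \<and>
        a t = fst (\<delta> t) * q t \<and> s t = p t * snd (\<delta> t) - r t * fst (\<delta> t)"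
    and cont: "continuous_on {t0..t1} h" "continuous_on {t0..t1} a" "continuous_on {t0..t1} s"
    using assms(1) unfolding arc_densities_def by blast
  note frD = moving_frameD[OF fr]
  have mem: "\<alpha> * u + \<beta> \<in> {t0<..<t1}" if "u \<in> {u0<..<u1}" for u
    using that \<alpha> by (auto simp: t)
  have maps: "(\<lambda>u. \<alpha> * u + \<beta>) ` {u0..u1} \<subseteq> {t0..t1}"
    using \<alpha> by (auto simp: t)
  have chain: "((\<lambda>u. F (\<alpha> * u + \<beta>)) has_real_derivative D * \<alpha>) (at u)"
    if "(F has_real_derivative D) (at (\<alpha> * u + \<beta>))" for F D u
    by (rule DERIV_chain2[where f = F and g = "\<lambda>u. \<alpha> * u + \<beta>"])
      (use that in \<open>auto intro!: derivative_eq_intros\<close>)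
  have "moving_frame \<gamma> (\<lambda>u. \<alpha> * q (\<alpha> * u + \<beta>)) (\<lambda>u. p (\<alpha> * u + \<beta>)) (\<lambda>u. r (\<alpha> * u + \<beta>))
      (\<lambda>u. \<alpha> * \<omega> (\<alpha> * u + \<beta>)) {u0<..<u1}"
    unfolding moving_frame_def
  proof (intro conjI ballI)
    fix u assume u: "u \<in> {u0<..<u1}"
    note m = mem[OF u]
    show "0 < fst (\<gamma> u)" "0 < \<alpha> * q (\<alpha> * u + \<beta>)" "(p (\<alpha> * u + \<beta>))\<^sup>2 + (r (\<alpha> * u + \<beta>))\<^sup>2 = 1"
      using frD(2,3,6)[OF m] \<alpha> u by (auto simp: \<gamma>)
    show "((\<lambda>u. fst (\<gamma> u)) has_real_derivative \<alpha> * q (\<alpha> * u + \<beta>) * p (\<alpha> * u + \<beta>)) (at u)"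
      using chain[OF frD(4)[OF m]]
      by (rule has_field_derivative_transform_within_open[where S = "{u0<..<u1}", THEN DERIV_cong])
        (use u \<gamma> in auto)
    show "((\<lambda>u. snd (\<gamma> u)) has_real_derivative \<alpha> * q (\<alpha> * u + \<beta>) * r (\<alpha> * u + \<beta>)) (at u)"
      using chain[OF frD(5)[OF m]]
      by (rule has_field_derivative_transform_within_open[where S = "{u0<..<u1}", THEN DERIV_cong])
        (use u \<gamma> in auto)
    show "((\<lambda>u. p (\<alpha> * u + \<beta>)) has_real_derivative \<alpha> * \<omega> (\<alpha> * u + \<beta>) * r (\<alpha> * u + \<beta>)) (at u)"
      using chain[OF frD(7)[OF m]] by (simp add: mult_ac)
    show "((\<lambda>u. r (\<alpha> * u + \<beta>)) has_real_derivative - (\<alpha> * \<omega> (\<alpha> * u + \<beta>)) * p (\<alpha> * u + \<beta>)) (at u)"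
      using chain[OF frD(8)[OF m]] by (simp add: mult_ac)
  qed auto
  moreover have "\<forall>u\<in>{u0<..<u1}. h (\<alpha> * u + \<beta>) =
        (\<alpha> * \<omega> (\<alpha> * u + \<beta>) / (\<alpha> * q (\<alpha> * u + \<beta>)) - r (\<alpha> * u + \<beta>) / fst (\<gamma> u))\<^sup>2 / 4 \<and>
      \<alpha> * a (\<alpha> * u + \<beta>) = fst (\<gamma> u) * (\<alpha> * q (\<alpha> * u + \<beta>)) \<and>
      s (\<alpha> * u + \<beta>) = p (\<alpha> * u + \<beta>) * snd (\<gamma> u) - r (\<alpha> * u + \<beta>) * fst (\<gamma> u)"
    using eqs mem \<gamma> \<alpha> by auto
  moreover have "continuous_on {u0..u1} (\<lambda>u. h (\<alpha> * u + \<beta>))"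
      "continuous_on {u0..u1} (\<lambda>u. \<alpha> * a (\<alpha> * u + \<beta>))"
      "continuous_on {u0..u1} (\<lambda>u. s (\<alpha> * u + \<beta>))"
    using maps
    by (auto intro!: continuous_intros continuous_on_compose2[OF cont(1)]
        continuous_on_compose2[OF cont(2)] continuous_on_compose2[OF cont(3)])
  ultimately show ?thesis
    unfolding arc_densities_def by (intro conjI exI[of _ "\<lambda>u. \<alpha> * q (\<alpha> * u + \<beta>)"]
        exI[of _ "\<lambda>u. p (\<alpha> * u + \<beta>)"] exI[of _ "\<lambda>u. r (\<alpha> * u + \<beta>)"] exI[of _ "\<lambda>u. \<alpha> * \<omega> (\<alpha> * u + \<beta>)"])
qed

lemma integral_affine:
  fixes k :: "real \<Rightarrow> real"
  assumes "\<alpha> > 0" "continuous_on {\<alpha> * u0 + \<beta>..\<alpha> * u1 + \<beta>} k"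
  shows "integral {u0..u1} (\<lambda>u. \<alpha> * k (\<alpha> * u + \<beta>)) = integral {\<alpha> * u0 + \<beta>..\<alpha> * u1 + \<beta>} k"
proof -
  have "(k has_integral integral {\<alpha> * u0 + \<beta>..\<alpha> * u1 + \<beta>} k) (cbox (\<alpha> * u0 + \<beta>) (\<alpha> * u1 + \<beta>))"
    using integrable_continuous_real[OF assms(2)] by (simp add: integrable_integral)
  from has_integral_mult_right[OF has_integral_affinity'[OF this assms(1), of \<beta>], of \<alpha>] assms(1)
  show ?thesis by (intro integral_unique) (simp flip: mult.assoc)
qed

text \<open>The factor \<open>\<alpha>\<close> is absorbed by substitution, so the values are
  integrals in the own parameter of the arc. Agreement of the curves is asked only inside the band;
  what \<open>+++\<close> does at a junction is irrelevant.\<close>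

lemma has_functionals_on_arc:
  assumes arc: "arc_densities \<delta> t0 t1 h a s" and \<alpha>: "\<alpha> > 0" and "u0 \<le> u1"
    and t: "t0 = \<alpha> * u0 + \<beta>" "t1 = \<alpha> * u1 + \<beta>"
    and \<gamma>: "\<And>u. u0 < u \<Longrightarrow> u < u1 \<Longrightarrow> \<gamma> u = \<delta> (\<alpha> * u + \<beta>)"
    and eps: "\<epsilon> = 1 \<or> \<epsilon> = -1"
  shows "has_functionals_on (revolution \<gamma> \<epsilon>) u0 u1
    (2 * pi * integral {t0..t1} (\<lambda>t. a t * h t))
    (2 * pi * integral {t0..t1} a)
    (\<epsilon> * (2 * pi * integral {t0..t1} (\<lambda>t. a t * s t)))"
proof -
  define h' a' s' where "h' = (\<lambda>u. h (\<alpha> * u + \<beta>))" and "a' = (\<lambda>u. \<alpha> * a (\<alpha> * u + \<beta>))"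
    and "s' = (\<lambda>u. s (\<alpha> * u + \<beta>))"
  have "arc_densities \<gamma> u0 u1 h' a' s'"
    unfolding h'_def a'_def s'_def by (rule arc_densities_reparam[OF arc \<alpha> t \<gamma>])
  then obtain q p r \<omega> where fr: "moving_frame \<gamma> q p r \<omega> {u0<..<u1}"
    and eqs: "\<And>u. u \<in> {u0<..<u1} \<Longrightarrow> h' u = (\<omega> u / q u - r u / fst (\<gamma> u))\<^sup>2 / 4 \<and>
        a' u = fst (\<gamma> u) * q u \<and> s' u = p u * snd (\<gamma> u) - r u * fst (\<gamma> u)"
    and cont: "continuous_on {u0..u1} h'" "continuous_on {u0..u1} a'" "continuous_on {u0..u1} s'"
    unfolding arc_densities_def by blast
  note geo = revolution_geometry[OF fr _ eps]
  have c: "continuous_on {t0..t1} h" "continuous_on {t0..t1} a" "continuous_on {t0..t1} s"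
    using arc unfolding arc_densities_def by auto
  have W: "integral {u0..u1} (\<lambda>u. a' u * h' u) = integral {t0..t1} (\<lambda>t. a t * h t)"
    using integral_affine[of \<alpha> u0 \<beta> u1 "\<lambda>t. a t * h t"] \<alpha> c
    by (simp add: a'_def h'_def t mult.assoc continuous_on_mult)
  have A: "integral {u0..u1} a' = integral {t0..t1} a"
    using integral_affine[of \<alpha> u0 \<beta> u1 a] \<alpha> c by (simp add: a'_def t)
  have V: "integral {u0..u1} (\<lambda>u. a' u * (\<epsilon> * s' u)) = \<epsilon> * integral {t0..t1} (\<lambda>t. a t * s t)"
    using integral_affine[of \<alpha> u0 \<beta> u1 "\<lambda>t. a t * (\<epsilon> * s t)"] \<alpha> c
    by (simp add: a'_def s'_def t mult.assoc mult.left_commute[of _ \<epsilon>] continuous_intros)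
  let ?S = "revolution \<gamma> \<epsilon>"
  have "norm (param_normal (param ?S) (u, \<theta>)) = a' u" "(mean_curvature ?S (u, \<theta>))\<^sup>2 = h' u"
      "gauss_map ?S (u, \<theta>) \<bullet> param ?S (u, \<theta>) = \<epsilon> * s' u" if "u0 < u" "u < u1" for u \<theta>
    using that by (simp_all add: eqs geo)
  note ev = this cont \<open>u0 \<le> u1\<close>
  have "has_band_integral (\<lambda>z. norm (param_normal (param ?S) z) * (mean_curvature ?S z)\<^sup>2) u0 u1
      (2 * pi * integral {u0..u1} (\<lambda>u. a' u * h' u))"
    by (rule has_band_integral_continuous) (use ev in \<open>auto intro!: continuous_intros\<close>)
  moreover have "has_band_integral (\<lambda>z. norm (param_normal (param ?S) z)) u0 u1
      (2 * pi * integral {u0..u1} a')"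
    by (rule has_band_integral_continuous) (use ev in \<open>auto intro!: continuous_intros\<close>)
  moreover have "has_band_integral
      (\<lambda>z. norm (param_normal (param ?S) z) * (gauss_map ?S z \<bullet> param ?S z)) u0 u1
      (2 * pi * integral {u0..u1} (\<lambda>u. a' u * (\<epsilon> * s' u)))"
    by (rule has_band_integral_continuous) (use ev in \<open>auto intro!: continuous_intros\<close>)
  moreover have "has_band_integral (\<lambda>z. (mean_curvature ?S z)\<^sup>2) u0 u1 (2 * pi * integral {u0..u1} h')"
    by (rule has_band_integral_continuous) (use ev in \<open>auto intro!: continuous_intros\<close>)
  moreover have "has_band_integral (\<lambda>z. gauss_map ?S z \<bullet> param ?S z) u0 u1
      (2 * pi * integral {u0..u1} (\<lambda>u. \<epsilon> * s' u))"
    by (rule has_band_integral_continuous) (use ev in \<open>auto intro!: continuous_intros\<close>)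
  ultimately show ?thesis
    unfolding has_functionals_on_def W A V by (auto simp: mult_ac)
qed

section \<open>The arcs of the profile curves\<close>

lemma arc_densitiesI:
  assumes "moving_frame \<delta> q p r \<omega> {t0<..<t1}"
    and "continuous_on {t0..t1} h" "continuous_on {t0..t1} a" "continuous_on {t0..t1} s"
    and "\<And>t. t0 < t \<Longrightarrow> t < t1 \<Longrightarrow> h t = (\<omega> t / q t - r t / fst (\<delta> t))\<^sup>2 / 4"
    and "\<And>t. t0 < t \<Longrightarrow> t < t1 \<Longrightarrow> a t = fst (\<delta> t) * q t"
    and "\<And>t. t0 < t \<Longrightarrow> t < t1 \<Longrightarrow> s t = p t * snd (\<delta> t) - r t * fst (\<delta> t)"
  shows "arc_densities \<delta> t0 t1 h a s"
  unfolding arc_densities_def using assms by (intro conjI exI[of _ q] exI[of _ p] exI[of _ r] exI[of _ \<omega>]) auto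

text \<open>Positivity of \<open>t\<close> matters: for negative \<open>t\<close> the interval is
  empty and the integral is constantly 0.\<close>

lemma DERIV_integral_from_0:
  fixes \<phi> :: "real \<Rightarrow> real"
  assumes "continuous_on UNIV \<phi>" "t > 0"
  shows "((\<lambda>t. integral {0..t} \<phi>) has_real_derivative \<phi> t) (at t)"
proof -
  have "((\<lambda>t. integral {0..t} \<phi>) has_real_derivative \<phi> t) (at t within {0..t + 1})"
    by (rule integral_has_real_derivative) (use assms continuous_on_subset in auto)
  moreover have "at t within {0..t + 1} = at t"
    using assms(2) by (intro at_within_interior) auto
  ultimately show ?thesis by simp
qed

lemma continuous_on_integral_from_0:
  fixes \<phi> :: "real \<Rightarrow> real"
  assumes "continuous_on UNIV \<phi>" "0 \<le> t0"
  shows "continuous_on {t0..t1} (\<lambda>t. integral {0..t} \<phi>)"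
proof -
  have "\<phi> integrable_on {0..t1}"
    using assms(1) continuous_on_subset by (intro integrable_continuous_real) auto
  then show ?thesis
    using assms(2) by (intro continuous_on_subset[OF indefinite_integral_continuous_1]) auto
qed

lemma arc_densitiesD:
  assumes "arc_densities \<delta> t0 t1 h a s"
  shows "continuous_on {t0..t1} h" "continuous_on {t0..t1} a" "continuous_on {t0..t1} s"
  using assms by (auto simp: arc_densities_def)

lemma arc_densities_axis_circle:
  assumes "\<rho> > 0"
  shows "arc_densities (axis_circle h \<rho>) 0 (pi / 2) (\<lambda>_. 1 / \<rho>\<^sup>2) (\<lambda>t. \<rho>\<^sup>2 * cos t)
    (\<lambda>t. - (h * sin t + \<rho>))"
proof (rule arc_densitiesI)
  show "moving_frame (axis_circle h \<rho>) (\<lambda>_. \<rho>) (\<lambda>t. - sin t) cos (\<lambda>_. - 1) {0<..<pi / 2}"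
    unfolding moving_frame_def axis_circle_def using assms
    by (auto intro!: derivative_eq_intros mult_pos_pos cos_gt_zero)
  fix t :: real assume "0 < t" "t < pi / 2"
  then have "cos t > 0" by (simp add: cos_gt_zero)
  then show "1 / \<rho>\<^sup>2 = (- 1 / \<rho> - cos t / fst (axis_circle h \<rho> t))\<^sup>2 / 4"
    using assms by (simp add: axis_circle_def field_simps power2_eq_square)
  show "- (h * sin t + \<rho>) = - sin t * snd (axis_circle h \<rho> t) - cos t * fst (axis_circle h \<rho> t)"
  proof -
    have "\<rho> * (sin t * sin t) + \<rho> * (cos t * cos t) = \<rho>"
      by (simp flip: distrib_left power2_eq_square)
    then show ?thesis
      by (simp add: axis_circle_def algebra_simps)
  qed
qed (auto simp: axis_circle_def power2_eq_square intro!: continuous_intros)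

text \<open>The reversed arc is not an instance of \<open>arc_densities_reparam\<close>, which
  preserves direction. Leaving the pole gives the outward normal for positive orientation, arriving
  at it gives the inward one. The opposite signs of the two support functions let the caps cancel in
  the limit volume.\<close>

lemma arc_densities_axis_circle_reversed:
  assumes "\<rho> > 0"
  shows "arc_densities (\<lambda>t. axis_circle h \<rho> (pi / 2 - t)) 0 (pi / 2) (\<lambda>_. 1 / \<rho>\<^sup>2)
    (\<lambda>t. \<rho>\<^sup>2 * sin t) (\<lambda>t. h * cos t + \<rho>)"
proof -
  have "arc_densities (\<lambda>t. (\<rho> * sin t, h + \<rho> * cos t)) 0 (pi / 2) (\<lambda>_. 1 / \<rho>\<^sup>2)
    (\<lambda>t. \<rho>\<^sup>2 * sin t) (\<lambda>t. h * cos t + \<rho>)"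
  proof (rule arc_densitiesI)
    show "moving_frame (\<lambda>t. (\<rho> * sin t, h + \<rho> * cos t)) (\<lambda>_. \<rho>) cos (\<lambda>t. - sin t) (\<lambda>_. 1) {0<..<pi / 2}"
      unfolding moving_frame_def using assms
      by (auto intro!: derivative_eq_intros mult_pos_pos sin_gt_zero)
    fix t :: real assume "0 < t" "t < pi / 2"
    then have "sin t > 0" by (simp add: sin_gt_zero)
    then show "1 / \<rho>\<^sup>2 = (1 / \<rho> - - sin t / fst (\<rho> * sin t, h + \<rho> * cos t))\<^sup>2 / 4"
      using assms by (simp add: field_simps power2_eq_square)
    show "h * cos t + \<rho> =
        cos t * snd (\<rho> * sin t, h + \<rho> * cos t) - - sin t * fst (\<rho> * sin t, h + \<rho> * cos t)"
    proof -
      have "\<rho> * (sin t * sin t) + \<rho> * (cos t * cos t) = \<rho>"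
        by (simp flip: distrib_left power2_eq_square)
      then show ?thesis
        by (simp add: algebra_simps)
    qed
  qed (auto simp: power2_eq_square intro!: continuous_intros)
  then show ?thesis
    by (simp add: axis_circle_def cos_diff sin_diff)
qed

section \<open>The nodoid: constant mean curvature 1/2 up to sign\<close>

lemma nodoid_radicand_pos:
  assumes "c > (1 :: real)"
  shows "c\<^sup>2 - (sin s)\<^sup>2 > 0"
proof -
  have "(sin s)\<^sup>2 \<le> 1" by (simp add: abs_square_le_1)
  moreover have "c\<^sup>2 > 1" using assms by simp
  ultimately show ?thesis by linarith
qed

lemma fst_nodoid_pos:
  assumes "c > 1"
  shows "fst (nodoid c L s) > 0"
proof -
  have "(cos s)\<^sup>2 < c\<^sup>2 - (sin s)\<^sup>2"
    using assms by (simp add: cos_squared_eq)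
  then have "\<bar>cos s\<bar> < sqrt (c\<^sup>2 - (sin s)\<^sup>2)"
    by (metis real_sqrt_abs real_sqrt_less_mono)
  then show ?thesis by (simp add: nodoid_def)
qed

lemma continuous_on_nodoid_height_integrand:
  assumes "c > (1 :: real)"
  shows "continuous_on UNIV (\<lambda>x. cos x - (cos x)\<^sup>2 / sqrt (c\<^sup>2 - (sin x)\<^sup>2))"
  using nodoid_radicand_pos[OF assms] by (intro continuous_intros) (simp add: less_imp_neq[symmetric])

lemma DERIV_nodoid:
  assumes "c > 1"
  shows "((\<lambda>s. fst (nodoid c L s)) has_real_derivative (1 - cos s / sqrt (c\<^sup>2 - (sin s)\<^sup>2)) * sin s) (at s)"
    and "s > 0 \<Longrightarrow> ((\<lambda>s. snd (nodoid c L s)) has_real_derivative (1 - cos s / sqrt (c\<^sup>2 - (sin s)\<^sup>2)) * cos s) (at s)"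
proof -
  note pos = nodoid_radicand_pos[OF assms, of s]
  show "((\<lambda>s. fst (nodoid c L s)) has_real_derivative (1 - cos s / sqrt (c\<^sup>2 - (sin s)\<^sup>2)) * sin s) (at s)"
    unfolding nodoid_def fst_conv using pos
    by (auto intro!: derivative_eq_intros simp: field_simps)
  assume "s > 0"
  then show "((\<lambda>s. snd (nodoid c L s)) has_real_derivative (1 - cos s / sqrt (c\<^sup>2 - (sin s)\<^sup>2)) * cos s) (at s)"
    unfolding nodoid_def snd_conv
    using DERIV_add[OF DERIV_const[of L] DERIV_integral_from_0[OF continuous_on_nodoid_height_integrand[OF assms]]]
    by (simp add: algebra_simps power2_eq_square)
qed

lemma continuous_on_nodoid:
  assumes "c > 1" "0 \<le> t0"
  shows "continuous_on T (\<lambda>s. fst (nodoid c L s))"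
    and "continuous_on {t0..t1} (\<lambda>s. snd (nodoid c L s))"
  unfolding nodoid_def fst_conv snd_conv
  by (intro continuous_intros continuous_on_integral_from_0 continuous_on_nodoid_height_integrand assms)+

definition nodoid_area :: "real \<Rightarrow> real \<Rightarrow> real \<Rightarrow> real"
  where "nodoid_area c L s = (fst (nodoid c L s))\<^sup>2 / sqrt (c\<^sup>2 - (sin s)\<^sup>2)"

definition nodoid_support :: "real \<Rightarrow> real \<Rightarrow> real \<Rightarrow> real"
  where "nodoid_support c L s = sin s * snd (nodoid c L s) - cos s * fst (nodoid c L s)"

text \<open>The parameter \<open>s\<close> is the angle of the tangent against the axis, hence the
  frame (sin, cos) with turning rate 1.\<close>

lemma arc_densities_nodoid:
  assumes c: "c > 1" and "0 \<le> t0"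
  shows "arc_densities (nodoid c L) t0 t1 (\<lambda>_. 1 / 4)
    (nodoid_area c L) (nodoid_support c L)"
  unfolding nodoid_area_def[abs_def] nodoid_support_def[abs_def]
proof (rule arc_densitiesI)
  note rad = nodoid_radicand_pos[OF c]
  note fpos = fst_nodoid_pos[OF c]
  \<comment> \<open>The speed is f divided by the root. This turns f q into
    \<open>nodoid_area\<close>, and puts both principal curvatures over the denominator f, where
    their sum becomes (root - cos) / f = 1.\<close>
  have q: "1 - cos s / sqrt (c\<^sup>2 - (sin s)\<^sup>2) = fst (nodoid c L s) / sqrt (c\<^sup>2 - (sin s)\<^sup>2)" for s
    using rad[of s] by (simp add: nodoid_def field_simps)
  show "moving_frame (nodoid c L) (\<lambda>s. 1 - cos s / sqrt (c\<^sup>2 - (sin s)\<^sup>2)) sin cos (\<lambda>_. 1) {t0<..<t1}"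
    unfolding moving_frame_def
  proof (intro conjI ballI)
    fix s assume "s \<in> {t0<..<t1}"
    then show "((\<lambda>s. snd (nodoid c L s)) has_real_derivative (1 - cos s / sqrt (c\<^sup>2 - (sin s)\<^sup>2)) * cos s) (at s)"
      using assms by (intro DERIV_nodoid) auto
    show "1 - cos s / sqrt (c\<^sup>2 - (sin s)\<^sup>2) > 0"
      unfolding q using fpos rad by simp
  qed (auto intro!: derivative_eq_intros DERIV_nodoid c fpos)
  show "continuous_on {t0..t1} (\<lambda>s. (fst (nodoid c L s))\<^sup>2 / sqrt (c\<^sup>2 - (sin s)\<^sup>2))"
    using rad by (intro continuous_intros continuous_on_nodoid[OF assms]) (simp add: less_imp_neq[symmetric])
  show "continuous_on {t0..t1} (\<lambda>s. sin s * snd (nodoid c L s) - cos s * fst (nodoid c L s))"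
    by (intro continuous_intros continuous_on_nodoid[OF assms])
  fix s
  show "1 / 4 = (1 / (1 - cos s / sqrt (c\<^sup>2 - (sin s)\<^sup>2)) - cos s / fst (nodoid c L s))\<^sup>2 / 4"
  proof -
    have "1 / (1 - cos s / sqrt (c\<^sup>2 - (sin s)\<^sup>2)) - cos s / fst (nodoid c L s) =
        (sqrt (c\<^sup>2 - (sin s)\<^sup>2) - cos s) / fst (nodoid c L s)"
      unfolding q by (simp add: diff_divide_distrib)
    also have "\<dots> = 1"
      using fpos[of L s] by (simp add: nodoid_def)
    finally show ?thesis by simp
  qed
  show "(fst (nodoid c L s))\<^sup>2 / sqrt (c\<^sup>2 - (sin s)\<^sup>2) = fst (nodoid c L s) * (1 - cos s / sqrt (c\<^sup>2 - (sin s)\<^sup>2))"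
    unfolding q by (simp add: power2_eq_square)
qed auto

section \<open>The unduloid: constant mean curvature 1/(2a) up to sign\<close>

definition unduloid_area :: "real \<Rightarrow> real \<Rightarrow> real \<Rightarrow> real"
  where "unduloid_area a y t = fst (unduloid a y t) * (a * sqrt (a\<^sup>2 - y\<^sup>2) / (a + y * cos t))"

definition unduloid_support :: "real \<Rightarrow> real \<Rightarrow> real \<Rightarrow> real"
  where "unduloid_support a y t =
    (y * sin t * snd (unduloid a y t) - sqrt (a\<^sup>2 - y\<^sup>2) * fst (unduloid a y t)) /
      sqrt (a\<^sup>2 - y\<^sup>2 * (cos t)\<^sup>2)"

context
  fixes a y :: real
  assumes y: "0 < y" and ya: "y < a"
begin

lemma unduloid_factors_pos: "a - y * cos t > 0" "a + y * cos t > 0"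
proof -
  have "\<bar>y * cos t\<bar> \<le> y"
    using y by (simp add: abs_mult mult_left_le)
  then show "a - y * cos t > 0" "a + y * cos t > 0"
    using ya by linarith+
qed

lemma unduloid_radicand: "a\<^sup>2 - y\<^sup>2 * (cos t)\<^sup>2 = (a - y * cos t) * (a + y * cos t)"
  by (simp add: power2_eq_square algebra_simps)

lemma unduloid_radicand_pos: "a\<^sup>2 - y\<^sup>2 * (cos t)\<^sup>2 > 0"
  unfolding unduloid_radicand using unduloid_factors_pos by simp

lemma unduloid_waist_pos: "a\<^sup>2 - y\<^sup>2 > 0"
  using y ya by (simp add: power_strict_mono)

text \<open>With the radicand AB for A = a - y cos t and B = a + y cos t, this is A / sqrt(AB) =
  sqrt(AB) / B. The right side is easier to differentiate, having no root in its
  denominator.\<close>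

lemma unduloid_ratio:
  "(a - y * cos t) / sqrt (a\<^sup>2 - y\<^sup>2 * (cos t)\<^sup>2) = sqrt (a\<^sup>2 - y\<^sup>2 * (cos t)\<^sup>2) / (a + y * cos t)"
  using unduloid_radicand_pos[of t] unduloid_factors_pos[of t]
  by (simp add: field_simps unduloid_radicand)

lemma unduloid_altdef:
  "unduloid a y t = (sqrt (a\<^sup>2 - y\<^sup>2) * (sqrt (a\<^sup>2 - y\<^sup>2 * (cos t)\<^sup>2) / (a + y * cos t)),
    integral {0..t} (\<lambda>x. sqrt (a\<^sup>2 - y\<^sup>2 * (cos x)\<^sup>2)) -
      y * sin t * (sqrt (a\<^sup>2 - y\<^sup>2 * (cos t)\<^sup>2) / (a + y * cos t)))"
  unfolding unduloid_def unduloid_ratio ..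

lemma fst_unduloid_pos: "fst (unduloid a y t) > 0"
  unfolding unduloid_altdef
  using unduloid_radicand_pos[of t] unduloid_factors_pos[of t] unduloid_waist_pos by simp

lemma DERIV_unduloid_root:
  "((\<lambda>t. sqrt (a\<^sup>2 - y\<^sup>2 * (cos t)\<^sup>2)) has_real_derivative
     y\<^sup>2 * cos t * sin t / sqrt (a\<^sup>2 - y\<^sup>2 * (cos t)\<^sup>2)) (at t)"
  using unduloid_radicand_pos[of t]
  by (auto intro!: derivative_eq_intros simp: field_simps)

lemma DERIV_unduloid_ratio:
  "((\<lambda>t. sqrt (a\<^sup>2 - y\<^sup>2 * (cos t)\<^sup>2) / (a + y * cos t)) has_real_derivative
     a * y * sin t / (sqrt (a\<^sup>2 - y\<^sup>2 * (cos t)\<^sup>2) * (a + y * cos t))) (at t)"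
proof -
  define R where "R = sqrt (a\<^sup>2 - y\<^sup>2 * (cos t)\<^sup>2)"
  have R: "R > 0" "R * R = (a - y * cos t) * (a + y * cos t)"
    unfolding R_def using unduloid_radicand_pos[of t] by (simp_all add: unduloid_radicand)
  note pos = unduloid_factors_pos[of t]
  have "((\<lambda>t. sqrt (a\<^sup>2 - y\<^sup>2 * (cos t)\<^sup>2) / (a + y * cos t)) has_real_derivative
      ((y\<^sup>2 * cos t * sin t / R) * (a + y * cos t) - R * (- y * sin t)) / ((a + y * cos t) * (a + y * cos t))) (at t)"
    unfolding R_def using pos
    by (intro DERIV_divide DERIV_unduloid_root) (auto intro!: derivative_eq_intros)
  moreover have "((y\<^sup>2 * cos t * sin t / R) * (a + y * cos t) - R * (- y * sin t)) / ((a + y * cos t) * (a + y * cos t))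
      = (y * sin t * (y * cos t * (a + y * cos t) + R * R)) / (R * ((a + y * cos t) * (a + y * cos t)))"
    using R(1) pos by (simp add: field_simps power2_eq_square)
  \<comment> \<open>With R^2 factored, the bracket is (a + y cos t)(y cos t + a - y cos t), and so
    one factor cancels.\<close>
  moreover have "\<dots> = a * y * sin t / (R * (a + y * cos t))"
    unfolding R(2) using R(1) pos by (simp add: divide_simps) (simp add: algebra_simps)
  ultimately show ?thesis by (simp add: R_def)
qed

lemma continuous_on_unduloid_root: "continuous_on T (\<lambda>x. sqrt (a\<^sup>2 - y\<^sup>2 * (cos x)\<^sup>2))"
  by (intro continuous_intros)

text \<open>Both derivatives are displayed as speed ab / (a + y cos t) times a component of (y sin
  t, b) / R, where b is the root of a^2 - y^2. This vector is a unit vector because R^2 = b^2 + y^2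
  sin^2 t.\<close>

lemma DERIV_unduloid:
  shows "((\<lambda>t. fst (unduloid a y t)) has_real_derivative
      a * sqrt (a\<^sup>2 - y\<^sup>2) / (a + y * cos t) * (y * sin t / sqrt (a\<^sup>2 - y\<^sup>2 * (cos t)\<^sup>2))) (at t)"
    and "t > 0 \<Longrightarrow> ((\<lambda>t. snd (unduloid a y t)) has_real_derivative
      a * sqrt (a\<^sup>2 - y\<^sup>2) / (a + y * cos t) * (sqrt (a\<^sup>2 - y\<^sup>2) / sqrt (a\<^sup>2 - y\<^sup>2 * (cos t)\<^sup>2))) (at t)"
proof -
  define R where "R = sqrt (a\<^sup>2 - y\<^sup>2 * (cos t)\<^sup>2)"
  have R: "R > 0" "R * R = (a - y * cos t) * (a + y * cos t)"
    unfolding R_def using unduloid_radicand_pos[of t] by (simp_all add: unduloid_radicand)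
  note pos = unduloid_factors_pos[of t]
  show "((\<lambda>t. fst (unduloid a y t)) has_real_derivative
      a * sqrt (a\<^sup>2 - y\<^sup>2) / (a + y * cos t) * (y * sin t / sqrt (a\<^sup>2 - y\<^sup>2 * (cos t)\<^sup>2))) (at t)"
    unfolding unduloid_altdef fst_conv
    by (rule DERIV_cmult[OF DERIV_unduloid_ratio, THEN DERIV_cong]) (simp add: mult_ac)
  assume "t > 0"
  then have "((\<lambda>t. snd (unduloid a y t)) has_real_derivative
      R - (y * cos t * (R / (a + y * cos t)) + (a * y * sin t / (R * (a + y * cos t))) * (y * sin t))) (at t)"
    unfolding unduloid_altdef snd_conv R_def
    by (intro DERIV_diff DERIV_integral_from_0 DERIV_mult DERIV_unduloid_ratio continuous_on_unduloid_root)
      (auto intro!: derivative_eq_intros)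
  moreover have "R - (y * cos t * (R / (a + y * cos t)) + (a * y * sin t / (R * (a + y * cos t))) * (y * sin t))
      = a * (R * R - y\<^sup>2 * (sin t)\<^sup>2) / (R * (a + y * cos t))"
    using R(1) pos by (simp add: divide_simps) (simp add: algebra_simps power2_eq_square)
  moreover have "R * R - y\<^sup>2 * (sin t)\<^sup>2 = a\<^sup>2 - y\<^sup>2"
    unfolding R(2) sin_squared_eq by (simp add: algebra_simps power2_eq_square)
  moreover have "a\<^sup>2 - y\<^sup>2 = sqrt (a\<^sup>2 - y\<^sup>2) * sqrt (a\<^sup>2 - y\<^sup>2)"
    using unduloid_waist_pos by simp
  ultimately show "((\<lambda>t. snd (unduloid a y t)) has_real_derivative
      a * sqrt (a\<^sup>2 - y\<^sup>2) / (a + y * cos t) * (sqrt (a\<^sup>2 - y\<^sup>2) / sqrt (a\<^sup>2 - y\<^sup>2 * (cos t)\<^sup>2))) (at t)"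
    unfolding R_def by (simp add: mult_ac)
qed

lemma continuous_on_unduloid:
  shows "continuous_on T (\<lambda>t. fst (unduloid a y t))"
    and "0 \<le> t0 \<Longrightarrow> continuous_on {t0..t1} (\<lambda>t. snd (unduloid a y t))"
  using unduloid_factors_pos(2) unfolding unduloid_altdef fst_conv snd_conv
  by (auto intro!: continuous_intros continuous_on_integral_from_0 simp: less_imp_neq[symmetric])

text \<open>The turning rate b y cos t / R^2 is the derivative of the tangent angle arctan (y sin t
  / b). The curvatures become y cos t / (a (a - y cos t)) and -1 / (a - y cos t), with sum
  -1/a.\<close>

lemma arc_densities_unduloid:
  assumes "0 \<le> t0"
  shows "arc_densities (unduloid a y) t0 t1 (\<lambda>_. 1 / (4 * a\<^sup>2))
    (unduloid_area a y) (unduloid_support a y)"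
  unfolding unduloid_area_def[abs_def] unduloid_support_def[abs_def]
proof (rule arc_densitiesI)
  define b where "b = sqrt (a\<^sup>2 - y\<^sup>2)"
  define R where "R = (\<lambda>t. sqrt (a\<^sup>2 - y\<^sup>2 * (cos t)\<^sup>2))"
  have b: "b > 0" "b\<^sup>2 = a\<^sup>2 - y\<^sup>2"
    unfolding b_def using unduloid_waist_pos by simp_all
  have R: "R t > 0" "(R t)\<^sup>2 = a\<^sup>2 - y\<^sup>2 * (cos t)\<^sup>2" for t
    unfolding R_def using unduloid_radicand_pos[of t] by simp_all
  note pos = unduloid_factors_pos
  have "a > 0" using y ya by simp
  have dR: "(R has_real_derivative y\<^sup>2 * cos t * sin t / R t) (at t)" for t
    unfolding R_def by (rule DERIV_unduloid_root)
  have Rs: "(R t)\<^sup>2 = b\<^sup>2 + y\<^sup>2 * (sin t)\<^sup>2" for t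
    by (simp add: R b sin_squared_eq algebra_simps)
  show "moving_frame (unduloid a y) (\<lambda>t. a * b / (a + y * cos t)) (\<lambda>t. y * sin t / R t) (\<lambda>t. b / R t)
    (\<lambda>t. b * y * cos t / (R t)\<^sup>2) {t0<..<t1}"
    unfolding moving_frame_def
  proof (intro conjI ballI)
    fix t assume t: "t \<in> {t0<..<t1}"
    show "0 < fst (unduloid a y t)"
      by (rule fst_unduloid_pos)
    show "0 < a * b / (a + y * cos t)"
      using pos b \<open>a > 0\<close> by simp
    show "((\<lambda>t. fst (unduloid a y t)) has_real_derivative a * b / (a + y * cos t) * (y * sin t / R t)) (at t)"
      unfolding b_def R_def by (rule DERIV_unduloid)
    show "((\<lambda>t. snd (unduloid a y t)) has_real_derivative a * b / (a + y * cos t) * (b / R t)) (at t)"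
      unfolding b_def R_def using t assms by (intro DERIV_unduloid) auto
    have "(y * sin t / R t)\<^sup>2 + (b / R t)\<^sup>2 = (b\<^sup>2 + y\<^sup>2 * (sin t)\<^sup>2) / (R t)\<^sup>2"
      by (simp add: power_divide power_mult_distrib add_divide_distrib)
    also have "\<dots> = 1"
      using R(1)[of t] by (simp flip: Rs)
    finally show "(y * sin t / R t)\<^sup>2 + (b / R t)\<^sup>2 = 1" .
    have "((\<lambda>t. y * sin t / R t) has_real_derivative
        (y * cos t * R t - y * sin t * (y\<^sup>2 * cos t * sin t / R t)) / (R t * R t)) (at t)"
      using R(1)[of t] by (intro DERIV_divide dR) (auto intro!: derivative_eq_intros)
    moreover have "(y * cos t * R t - y * sin t * (y\<^sup>2 * cos t * sin t / R t)) / (R t * R t) =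
        y * cos t * ((R t)\<^sup>2 - y\<^sup>2 * (sin t)\<^sup>2) / (R t * (R t)\<^sup>2)"
      using R(1)[of t] by (simp add: field_simps power2_eq_square)
    moreover have "(R t)\<^sup>2 - y\<^sup>2 * (sin t)\<^sup>2 = b * b"
      unfolding Rs by (simp add: power2_eq_square)
    ultimately show "((\<lambda>t. y * sin t / R t) has_real_derivative b * y * cos t / (R t)\<^sup>2 * (b / R t)) (at t)"
      by (simp add: mult_ac)
    show "((\<lambda>t. b / R t) has_real_derivative - (b * y * cos t / (R t)\<^sup>2) * (y * sin t / R t)) (at t)"
      using R(1)[of t] by (auto intro!: derivative_eq_intros dR simp: power2_eq_square mult_ac)
  qed auto
  show "continuous_on {t0..t1} (\<lambda>t. fst (unduloid a y t) * (a * sqrt (a\<^sup>2 - y\<^sup>2) / (a + y * cos t)))"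
    using pos by (intro continuous_intros continuous_on_unduloid) (simp add: less_imp_neq[symmetric])
  show "continuous_on {t0..t1} (\<lambda>t. (y * sin t * snd (unduloid a y t) - sqrt (a\<^sup>2 - y\<^sup>2) * fst (unduloid a y t)) /
      sqrt (a\<^sup>2 - y\<^sup>2 * (cos t)\<^sup>2))"
    using unduloid_radicand_pos assms by (intro continuous_intros continuous_on_unduloid) (auto simp: less_imp_neq[symmetric])
  fix t
  have "b * y * cos t / (R t)\<^sup>2 / (a * b / (a + y * cos t)) = y * cos t / (a * (a - y * cos t))"
    unfolding R(2) unduloid_radicand using b(1) \<open>a > 0\<close> pos[of t] by (simp add: divide_simps)
  moreover have "b / R t / fst (unduloid a y t) = 1 / (a - y * cos t)"
    using R(1)[of t] b(1) pos(1)[of t] by (simp add: unduloid_def b_def R_def)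
  moreover have "y * cos t / (a * (a - y * cos t)) - 1 / (a - y * cos t) = - (1 / a)"
    using \<open>a > 0\<close> pos(1)[of t] by (simp add: divide_simps)
  ultimately show "1 / (4 * a\<^sup>2) =
      (b * y * cos t / (R t)\<^sup>2 / (a * b / (a + y * cos t)) - b / R t / fst (unduloid a y t))\<^sup>2 / 4"
    by (simp add: power_divide)
  show "(y * sin t * snd (unduloid a y t) - sqrt (a\<^sup>2 - y\<^sup>2) * fst (unduloid a y t)) / sqrt (a\<^sup>2 - y\<^sup>2 * (cos t)\<^sup>2) =
      y * sin t / R t * snd (unduloid a y t) - b / R t * fst (unduloid a y t)"
    by (simp add: b_def R_def diff_divide_distrib)
qed auto

end

section \<open>Assembling the torus and the sphere\<close>

lemma integral_reflection_symmetric: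
  fixes w :: "real \<Rightarrow> real"
  assumes cont: "continuous_on {0..2 * b} w" and sym: "\<And>t. w (2 * b - t) = w t" and "b \<ge> 0"
  shows "integral {0..b} w = integral {0..2 * b} w / 2"
    and "integral {b..2 * b} w = integral {0..2 * b} w / 2"
proof -
  have "integral {- (2 * b) + 2 * b..- b + 2 * b} w = integral {- (2 * b)..- b} (w \<circ> (\<lambda>x. x + 2 * b))"
    by (rule integral_shift[symmetric]) (use cont \<open>b \<ge> 0\<close> in \<open>auto intro: continuous_on_subset\<close>)
  also have "w \<circ> (\<lambda>x. x + 2 * b) = (\<lambda>x. w (- x))"
  proof
    fix x show "(w \<circ> (\<lambda>x. x + 2 * b)) x = w (- x)"
      using sym[of "- x"] by (simp add: add.commute)
  qed
  finally have "integral {0..b} w = integral {b..2 * b} w"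
    by (simp add: integral_reflect_real)
  moreover have "integral {0..b} w + integral {b..2 * b} w = integral {0..2 * b} w"
    using assms by (intro Henstock_Kurzweil_Integration.integral_combine integrable_continuous_real) auto
  ultimately show "integral {0..b} w = integral {0..2 * b} w / 2"
    and "integral {b..2 * b} w = integral {0..2 * b} w / 2"
    by simp_all
qed

lemma delaunay_system_delaunay:
  assumes "delaunay_torus_exists c"
  shows "delaunay_system c (delaunay_a c) (delaunay_y c)"
proof -
  obtain a y where "case (a, y) of (a, y) \<Rightarrow> delaunay_system c a y"
    using assms unfolding delaunay_torus_exists_def by auto
  then have "case (SOME (a, y). delaunay_system c a y) of (a, y) \<Rightarrow> delaunay_system c a y"
    by (rule someI)
  then show ?thesis
    by (simp add: delaunay_a_def delaunay_y_def case_prod_unfold)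
qed

lemma delaunayD:
  assumes "delaunay_torus_exists c"
  shows "c > 1" "0 < delaunay_y c" "delaunay_y c < delaunay_a c"
    "delaunay_a c - delaunay_y c = c - 1"
    "delaunay_L c = 4 * c * (elliptic_E (1 / c) - (1 - 1 / c\<^sup>2) * elliptic_K (1 / c))"
  using delaunay_system_delaunay[OF assms] assms
  by (auto simp: delaunay_system_def delaunay_torus_exists_def delaunay_L_def)

lemma delaunay_torus_functionals:
  assumes ex: "delaunay_torus_exists c" and eps: "\<epsilon> = 1 \<or> \<epsilon> = -1"
  defines "a \<equiv> delaunay_a c" and "y \<equiv> delaunay_y c" and "L \<equiv> delaunay_L c"
  shows "has_functionals_on (revolution (delaunay_torus_profile c) \<epsilon>) 0 1
    (2 * pi * integral {0..2 * pi} (\<lambda>t. unduloid_area a y t * (1 / (4 * a\<^sup>2))) +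
      2 * pi * integral {0..2 * pi} (\<lambda>s. nodoid_area c L s * (1 / 4)))
    (2 * pi * integral {0..2 * pi} (unduloid_area a y) + 2 * pi * integral {0..2 * pi} (nodoid_area c L))
    (\<epsilon> * (2 * pi * integral {0..2 * pi} (\<lambda>t. unduloid_area a y t * unduloid_support a y t) +
      2 * pi * integral {0..2 * pi} (\<lambda>s. nodoid_area c L s * nodoid_support c L s)))"
  unfolding distrib_left[of \<epsilon>]
\<comment> \<open>A full period of length 2 pi is run over half of [0,1], so the slope is 4 pi; the
  second arc starts at u = 1/2, hence its offset -2 pi.\<close>
proof (rule has_functionals_on_combine[where ?u1.0 = "1 / 2"])
  note D = delaunayD[OF ex, folded a_def y_def L_def]
  show "has_functionals_on (revolution (delaunay_torus_profile c) \<epsilon>) 0 (1 / 2)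
    (2 * pi * integral {0..2 * pi} (\<lambda>t. unduloid_area a y t * (1 / (4 * a\<^sup>2))))
    (2 * pi * integral {0..2 * pi} (unduloid_area a y))
    (\<epsilon> * (2 * pi * integral {0..2 * pi} (\<lambda>t. unduloid_area a y t * unduloid_support a y t)))"
    by (rule has_functionals_on_arc[OF arc_densities_unduloid[OF D(2,3), of 0 "2 * pi"],
          where \<alpha> = "4 * pi" and \<beta> = 0])
      (auto simp: eps delaunay_torus_profile_def joinpaths_def subpath_def a_def y_def mult_ac)
  show "has_functionals_on (revolution (delaunay_torus_profile c) \<epsilon>) (1 / 2) 1
    (2 * pi * integral {0..2 * pi} (\<lambda>s. nodoid_area c L s * (1 / 4)))
    (2 * pi * integral {0..2 * pi} (nodoid_area c L))
    (\<epsilon> * (2 * pi * integral {0..2 * pi} (\<lambda>s. nodoid_area c L s * nodoid_support c L s)))"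
    by (rule has_functionals_on_arc[OF arc_densities_nodoid[OF D(1), of 0 L "2 * pi"],
          where \<alpha> = "4 * pi" and \<beta> = "- (2 * pi)"])
      (auto simp: eps delaunay_torus_profile_def joinpaths_def subpath_def L_def algebra_simps)
qed auto

lemma delaunay_sphere_functionals:
  assumes ex: "delaunay_torus_exists c" and eps: "\<epsilon> = 1 \<or> \<epsilon> = -1"
  defines "a \<equiv> delaunay_a c" and "y \<equiv> delaunay_y c" and "L \<equiv> delaunay_L c"
  shows "has_functionals_on (revolution (delaunay_sphere_profile c) \<epsilon>) 0 1
    (2 * pi * integral {0..pi / 2} (\<lambda>t. (c + 1)\<^sup>2 * sin t * (1 / (c + 1)\<^sup>2)) +
      (2 * pi * integral {pi..2 * pi} (\<lambda>s. nodoid_area c L s * (1 / 4)) +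
      (2 * pi * integral {0..pi} (\<lambda>t. unduloid_area a y t * (1 / (4 * a\<^sup>2))) +
      2 * pi * integral {0..pi / 2} (\<lambda>t. (a + y)\<^sup>2 * cos t * (1 / (a + y)\<^sup>2)))))
    (2 * pi * integral {0..pi / 2} (\<lambda>t. (c + 1)\<^sup>2 * sin t) +
      (2 * pi * integral {pi..2 * pi} (nodoid_area c L) +
      (2 * pi * integral {0..pi} (unduloid_area a y) +
      2 * pi * integral {0..pi / 2} (\<lambda>t. (a + y)\<^sup>2 * cos t))))
    (\<epsilon> * (2 * pi * integral {0..pi / 2} (\<lambda>t. (c + 1)\<^sup>2 * sin t * (L / 2 * cos t + (c + 1))) +
      (2 * pi * integral {pi..2 * pi} (\<lambda>s. nodoid_area c L s * nodoid_support c L s) +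
      (2 * pi * integral {0..pi} (\<lambda>t. unduloid_area a y t * unduloid_support a y t) +
      2 * pi * integral {0..pi / 2} (\<lambda>t. (a + y)\<^sup>2 * cos t * - (L / 2 * sin t + (a + y)))))))"
proof -
  note D = delaunayD[OF ex, folded a_def y_def L_def]
  let ?S = "revolution (delaunay_sphere_profile c) \<epsilon>"
  note defs = delaunay_sphere_profile_def joinpaths_def subpath_def a_def y_def L_def
  \<comment> \<open>As \<open>+++\<close> associates to the right, the four arcs occupy [0,1/2],
    [1/2,3/4], [3/4,7/8] and [7/8,1]. Each slope is the parameter length of the arc divided by the
    length of its interval, and the offset matches the left ends.\<close>
  have cap1: "has_functionals_on ?S 0 (1 / 2)
      (2 * pi * integral {0..pi / 2} (\<lambda>t. (c + 1)\<^sup>2 * sin t * (1 / (c + 1)\<^sup>2)))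
      (2 * pi * integral {0..pi / 2} (\<lambda>t. (c + 1)\<^sup>2 * sin t))
      (\<epsilon> * (2 * pi * integral {0..pi / 2} (\<lambda>t. (c + 1)\<^sup>2 * sin t * (L / 2 * cos t + (c + 1)))))"
    by (rule has_functionals_on_arc[OF arc_densities_axis_circle_reversed, where \<alpha> = pi and \<beta> = 0])
      (use D(1) in \<open>auto simp: eps defs algebra_simps\<close>)
  have nod: "has_functionals_on ?S (1 / 2) (3 / 4)
      (2 * pi * integral {pi..2 * pi} (\<lambda>s. nodoid_area c L s * (1 / 4)))
      (2 * pi * integral {pi..2 * pi} (nodoid_area c L))
      (\<epsilon> * (2 * pi * integral {pi..2 * pi} (\<lambda>s. nodoid_area c L s * nodoid_support c L s)))"
    by (rule has_functionals_on_arc[OF arc_densities_nodoid[OF D(1), of pi L "2 * pi"],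
          where \<alpha> = "4 * pi" and \<beta> = "- pi"])
      (auto simp: eps defs algebra_simps)
  have und: "has_functionals_on ?S (3 / 4) (7 / 8)
      (2 * pi * integral {0..pi} (\<lambda>t. unduloid_area a y t * (1 / (4 * a\<^sup>2))))
      (2 * pi * integral {0..pi} (unduloid_area a y))
      (\<epsilon> * (2 * pi * integral {0..pi} (\<lambda>t. unduloid_area a y t * unduloid_support a y t)))"
    by (rule has_functionals_on_arc[OF arc_densities_unduloid[OF D(2,3), of 0 pi],
          where \<alpha> = "8 * pi" and \<beta> = "- (6 * pi)"])
      (auto simp: eps defs algebra_simps)
  have cap2: "has_functionals_on ?S (7 / 8) 1
      (2 * pi * integral {0..pi / 2} (\<lambda>t. (a + y)\<^sup>2 * cos t * (1 / (a + y)\<^sup>2)))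
      (2 * pi * integral {0..pi / 2} (\<lambda>t. (a + y)\<^sup>2 * cos t))
      (\<epsilon> * (2 * pi * integral {0..pi / 2} (\<lambda>t. (a + y)\<^sup>2 * cos t * - (L / 2 * sin t + (a + y)))))"
    by (rule has_functionals_on_arc[OF arc_densities_axis_circle,
          where \<alpha> = "4 * pi" and \<beta> = "- (7 * pi / 2)"])
      (use D(2,3) in \<open>auto simp: eps defs algebra_simps diff_divide_distrib\<close>)
  show ?thesis
    unfolding distrib_left[of \<epsilon>]
    by (intro has_functionals_on_combine[OF cap1] has_functionals_on_combine[OF nod]
        has_functionals_on_combine[OF und cap2]) auto
qed

lemma integral_sin_quarter: "integral {0..pi / 2} sin = 1"
proof -
  have "(sin has_integral (- cos (pi / 2) - - cos 0)) {0..pi / 2}"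
    by (rule fundamental_theorem_of_calculus)
      (auto intro!: derivative_eq_intros simp flip: has_real_derivative_iff_has_vector_derivative)
  then show ?thesis by (auto intro: integral_unique)
qed

lemma integral_cos_quarter: "integral {0..pi / 2} cos = 1"
proof -
  have "(cos has_integral (sin (pi / 2) - sin 0)) {0..pi / 2}"
    by (rule fundamental_theorem_of_calculus)
      (auto intro!: derivative_eq_intros simp flip: has_real_derivative_iff_has_vector_derivative)
  then show ?thesis by (auto intro: integral_unique)
qed

lemma willmore_delaunay_sphere:
  assumes ex: "delaunay_torus_exists c"
  shows "willmore_energy (delaunay_sphere c) = 4 * pi + willmore_energy (delaunay_torus c) / 2"
proof -
  define a y L where "a = delaunay_a c" and "y = delaunay_y c" and "L = delaunay_L c"
  note D = delaunayD[OF ex, folded a_def y_def L_def]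
  let ?wU = "\<lambda>t. unduloid_area a y t * (1 / (4 * a\<^sup>2))" and ?wN = "\<lambda>s. nodoid_area c L s * (1 / 4)"
  have torus: "willmore_energy (delaunay_torus c) =
      2 * pi * integral {0..2 * pi} ?wU + 2 * pi * integral {0..2 * pi} ?wN"
    unfolding delaunay_torus_def
    by (rule surface_of_revolution_functionals(1),
        rule delaunay_torus_functionals[OF ex, folded a_def y_def L_def])
  have sphere: "willmore_energy (delaunay_sphere c) =
      2 * pi * integral {0..pi / 2} (\<lambda>t. (c + 1)\<^sup>2 * sin t * (1 / (c + 1)\<^sup>2)) +
      (2 * pi * integral {pi..2 * pi} ?wN + (2 * pi * integral {0..pi} ?wU +
      2 * pi * integral {0..pi / 2} (\<lambda>t. (a + y)\<^sup>2 * cos t * (1 / (a + y)\<^sup>2))))"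
    unfolding delaunay_sphere_def
    by (rule surface_of_revolution_functionals(1),
        rule delaunay_sphere_functionals[OF ex, folded a_def y_def L_def])
  have caps: "(\<lambda>t. (c + 1)\<^sup>2 * sin t * (1 / (c + 1)\<^sup>2)) = sin"
      "(\<lambda>t. (a + y)\<^sup>2 * cos t * (1 / (a + y)\<^sup>2)) = cos"
    using D by auto
  have contU: "continuous_on {0..2 * pi} (unduloid_area a y)"
    by (rule arc_densitiesD(2)[OF arc_densities_unduloid[OF D(2,3)]]) simp
  have contN: "continuous_on {0..2 * pi} (nodoid_area c L)"
    by (rule arc_densitiesD(2)[OF arc_densities_nodoid[OF D(1)]]) simp
  \<comment> \<open>The area densities depend on the parameter only through cos and sin^2, hence are
    symmetric about pi. The sphere uses the first half of the unduloid but the second half of the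
    nodoid.\<close>
  have "integral {0..pi} ?wU = integral {0..2 * pi} ?wU / 2"
    by (intro integral_reflection_symmetric(1) continuous_on_mult contU continuous_on_const)
      (simp_all add: unduloid_area_def unduloid_def)
  moreover have "integral {pi..2 * pi} ?wN = integral {0..2 * pi} ?wN / 2"
    by (intro integral_reflection_symmetric(2) continuous_on_mult contN continuous_on_const)
      (simp_all add: nodoid_area_def nodoid_def)
  ultimately show ?thesis
    unfolding torus sphere caps integral_sin_quarter integral_cos_quarter by (simp add: field_simps)
qed

section \<open>Volume under the arcs\<close>

text \<open>The derivative of f^2 g / 2 is v + (3/2) f^2 g'. This removes the height g, given only
  by an integral, from the integrand. Up to the factor pi, the remaining integral of f^2 g' is the
  signed volume between the arc and the axis.\<close>

lemma integral_volume_by_parts: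
  fixes f g :: "real \<Rightarrow> real"
  assumes "t0 \<le> t1" and cont: "continuous_on {t0..t1} f" "continuous_on {t0..t1} g"
    and int: "continuous_on {t0..t1} v" "continuous_on {t0..t1} k"
    and deriv: "\<And>t. t0 < t \<Longrightarrow> t < t1 \<Longrightarrow> (f has_real_derivative f' t) (at t)"
      "\<And>t. t0 < t \<Longrightarrow> t < t1 \<Longrightarrow> (g has_real_derivative g' t) (at t)"
    and v: "\<And>t. t0 < t \<Longrightarrow> t < t1 \<Longrightarrow> v t = f t * f' t * g t - (f t)\<^sup>2 * g' t"
    and k: "\<And>t. t0 < t \<Longrightarrow> t < t1 \<Longrightarrow> k t = (f t)\<^sup>2 * g' t"
  shows "integral {t0..t1} v =
    (f t1)\<^sup>2 * g t1 / 2 - (f t0)\<^sup>2 * g t0 / 2 - 3 / 2 * integral {t0..t1} k"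
proof -
  have "((\<lambda>t. v t + 3 / 2 * k t) has_integral (f t1)\<^sup>2 * g t1 / 2 - (f t0)\<^sup>2 * g t0 / 2) {t0..t1}"
  proof (rule fundamental_theorem_of_calculus_interior[OF \<open>t0 \<le> t1\<close>])
    show "continuous_on {t0..t1} (\<lambda>t. (f t)\<^sup>2 * g t / 2)"
      by (intro continuous_intros cont) auto
    fix t assume "t \<in> {t0<..<t1}"
    then show "((\<lambda>t. (f t)\<^sup>2 * g t / 2) has_vector_derivative v t + 3 / 2 * k t) (at t)"
      unfolding has_real_derivative_iff_has_vector_derivative[symmetric]
      by (auto intro!: derivative_eq_intros deriv simp: v k power2_eq_square field_simps)
  qed
  then have "integral {t0..t1} (\<lambda>t. v t + 3 / 2 * k t) = (f t1)\<^sup>2 * g t1 / 2 - (f t0)\<^sup>2 * g t0 / 2"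
    by (rule integral_unique)
  moreover have "integral {t0..t1} (\<lambda>t. v t + 3 / 2 * k t) = integral {t0..t1} v + 3 / 2 * integral {t0..t1} k"
    using int by (subst Henstock_Kurzweil_Integration.integral_add) (auto intro!: integrable_continuous_real continuous_intros)
  ultimately show ?thesis by simp
qed

text \<open>This is f^2 g', with g' kept in the form whose only quotient is cos^2 over the root,
  since that quotient stays continuous down to c = 1.\<close>

definition nodoid_slice :: "real \<Rightarrow> real \<Rightarrow> real"
  where "nodoid_slice c s =
    (sqrt (c\<^sup>2 - (sin s)\<^sup>2) - cos s)\<^sup>2 * (cos s - (cos s)\<^sup>2 / sqrt (c\<^sup>2 - (sin s)\<^sup>2))"

lemma nodoid_volume:
  assumes "c > 1"
  shows "integral {pi..2 * pi} (\<lambda>s. nodoid_area c L s * nodoid_support c L s) =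
    (c - 1)\<^sup>2 * snd (nodoid c L (2 * pi)) / 2 - (c + 1)\<^sup>2 * snd (nodoid c L pi) / 2
      - 3 / 2 * integral {pi..2 * pi} (nodoid_slice c)"
proof -
  note arc = arc_densities_nodoid[OF assms, of pi L "2 * pi"]
  have "integral {pi..2 * pi} (\<lambda>s. nodoid_area c L s * nodoid_support c L s) =
    (fst (nodoid c L (2 * pi)))\<^sup>2 * snd (nodoid c L (2 * pi)) / 2 - (fst (nodoid c L pi))\<^sup>2 * snd (nodoid c L pi) / 2
      - 3 / 2 * integral {pi..2 * pi} (nodoid_slice c)"
  proof (rule integral_volume_by_parts)
    show "continuous_on {pi..2 * pi} (\<lambda>s. fst (nodoid c L s))" "continuous_on {pi..2 * pi} (\<lambda>s. snd (nodoid c L s))"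
      using continuous_on_nodoid[OF assms, of pi] by auto
    show "continuous_on {pi..2 * pi} (\<lambda>s. nodoid_area c L s * nodoid_support c L s)"
      by (intro continuous_on_mult arc_densitiesD(2,3)[OF arc]) simp_all
    show "continuous_on {pi..2 * pi} (nodoid_slice c)"
      unfolding nodoid_slice_def
      by (intro continuous_intros continuous_on_subset[OF continuous_on_nodoid_height_integrand[OF assms]]) auto
    fix s assume s: "pi < s" "s < 2 * pi"
    show "((\<lambda>s. fst (nodoid c L s)) has_real_derivative (1 - cos s / sqrt (c\<^sup>2 - (sin s)\<^sup>2)) * sin s) (at s)"
      by (rule DERIV_nodoid[OF assms])
    show "((\<lambda>s. snd (nodoid c L s)) has_real_derivative (1 - cos s / sqrt (c\<^sup>2 - (sin s)\<^sup>2)) * cos s) (at s)"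
      using s(1) pi_gt_zero by (intro DERIV_nodoid[OF assms]) linarith
    have q: "(1 - cos s / sqrt (c\<^sup>2 - (sin s)\<^sup>2)) = fst (nodoid c L s) / sqrt (c\<^sup>2 - (sin s)\<^sup>2)"
      using nodoid_radicand_pos[OF assms, of s] by (simp add: nodoid_def field_simps)
    show "nodoid_area c L s * nodoid_support c L s =
      fst (nodoid c L s) * ((1 - cos s / sqrt (c\<^sup>2 - (sin s)\<^sup>2)) * sin s) * snd (nodoid c L s)
      - (fst (nodoid c L s))\<^sup>2 * ((1 - cos s / sqrt (c\<^sup>2 - (sin s)\<^sup>2)) * cos s)"
      unfolding q nodoid_area_def nodoid_support_def
      by (simp add: right_diff_distrib diff_divide_distrib power2_eq_square mult_ac)
    show "nodoid_slice c s = (fst (nodoid c L s))\<^sup>2 * ((1 - cos s / sqrt (c\<^sup>2 - (sin s)\<^sup>2)) * cos s)"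
      by (simp add: nodoid_slice_def nodoid_def algebra_simps power2_eq_square)
  qed auto
  moreover have "fst (nodoid c L (2 * pi)) = c - 1" "fst (nodoid c L pi) = c + 1"
    using assms by (simp_all add: nodoid_def)
  ultimately show ?thesis by simp
qed

definition unduloid_slice :: "real \<Rightarrow> real \<Rightarrow> real \<Rightarrow> real"
  where "unduloid_slice a y t = (fst (unduloid a y t))\<^sup>2 *
    (a * sqrt (a\<^sup>2 - y\<^sup>2) / (a + y * cos t) * (sqrt (a\<^sup>2 - y\<^sup>2) / sqrt (a\<^sup>2 - y\<^sup>2 * (cos t)\<^sup>2)))"

text \<open>Here \<open>\<tau>\<close> is the arc length of the unduloid divided by \<open>a\<close>.\<close>

definition unduloid_arclength_slice :: "real \<Rightarrow> real \<Rightarrow> real \<Rightarrow> real"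
  where "unduloid_arclength_slice a y \<tau> =
    a * (a - y * cos \<tau>) * sqrt (a\<^sup>2 + y\<^sup>2 - 2 * a * y * cos \<tau>)"

context
  fixes a y :: real
  assumes y: "0 < y" and ya: "y < a"
begin

lemma continuous_on_unduloid_slice: "continuous_on T (unduloid_slice a y)"
  unfolding unduloid_slice_def
  using unduloid_factors_pos[OF y ya] unduloid_radicand_pos[OF y ya]
  by (intro continuous_intros continuous_on_unduloid[OF y ya]) (auto simp: less_imp_neq[symmetric])

lemma unduloid_ends: "fst (unduloid a y 0) = a - y" "fst (unduloid a y pi) = a + y"
proof -
  have "sqrt (a\<^sup>2 - y\<^sup>2) \<noteq> 0"
    using unduloid_waist_pos[OF y ya] by simp
  then show "fst (unduloid a y 0) = a - y" "fst (unduloid a y pi) = a + y"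
    by (simp_all add: unduloid_def)
qed

lemma unduloid_volume:
  "integral {0..pi} (\<lambda>t. unduloid_area a y t * unduloid_support a y t) =
    (a + y)\<^sup>2 * snd (unduloid a y pi) / 2 - (a - y)\<^sup>2 * snd (unduloid a y 0) / 2
      - 3 / 2 * integral {0..pi} (unduloid_slice a y)"
  unfolding unduloid_ends[symmetric]
proof (rule integral_volume_by_parts)
  note arc = arc_densities_unduloid[OF y ya, of 0 pi]
  show "continuous_on {0..pi} (\<lambda>t. fst (unduloid a y t))" "continuous_on {0..pi} (\<lambda>t. snd (unduloid a y t))"
    using continuous_on_unduloid[OF y ya] by auto
  show "continuous_on {0..pi} (\<lambda>t. unduloid_area a y t * unduloid_support a y t)"
    by (intro continuous_on_mult arc_densitiesD(2,3)[OF arc]) simp_all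
  show "continuous_on {0..pi} (unduloid_slice a y)"
    by (rule continuous_on_unduloid_slice)
  fix t :: real assume "0 < t"
  then show "((\<lambda>t. snd (unduloid a y t)) has_real_derivative
      a * sqrt (a\<^sup>2 - y\<^sup>2) / (a + y * cos t) * (sqrt (a\<^sup>2 - y\<^sup>2) / sqrt (a\<^sup>2 - y\<^sup>2 * (cos t)\<^sup>2))) (at t)"
    by (rule DERIV_unduloid[OF y ya])
  show "((\<lambda>t. fst (unduloid a y t)) has_real_derivative
      a * sqrt (a\<^sup>2 - y\<^sup>2) / (a + y * cos t) * (y * sin t / sqrt (a\<^sup>2 - y\<^sup>2 * (cos t)\<^sup>2))) (at t)"
    by (rule DERIV_unduloid[OF y ya])
  show "unduloid_slice a y t = (fst (unduloid a y t))\<^sup>2 *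
      (a * sqrt (a\<^sup>2 - y\<^sup>2) / (a + y * cos t) * (sqrt (a\<^sup>2 - y\<^sup>2) / sqrt (a\<^sup>2 - y\<^sup>2 * (cos t)\<^sup>2)))"
    by (rule unduloid_slice_def)
  show "unduloid_area a y t * unduloid_support a y t =
      fst (unduloid a y t) *
      (a * sqrt (a\<^sup>2 - y\<^sup>2) / (a + y * cos t) * (y * sin t / sqrt (a\<^sup>2 - y\<^sup>2 * (cos t)\<^sup>2))) *
      snd (unduloid a y t) -
      (fst (unduloid a y t))\<^sup>2 *
      (a * sqrt (a\<^sup>2 - y\<^sup>2) / (a + y * cos t) * (sqrt (a\<^sup>2 - y\<^sup>2) / sqrt (a\<^sup>2 - y\<^sup>2 * (cos t)\<^sup>2)))"
    unfolding unduloid_area_def unduloid_support_def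
    by (simp add: diff_divide_distrib right_diff_distrib power2_eq_square mult_ac)
qed auto

text \<open>
  In the angle \<open>t\<close> the slices concentrate at \<open>t = pi\<close> as \<open>y\<close> tends to \<open>a\<close>. Passing to the arc length
  by \<open>cos t = (a cos \<tau> - y) / (a - y cos \<tau>)\<close> makes the integrand jointly continuous up to \<open>y = a\<close>.
\<close>

lemma integral_unduloid_slice:
  "integral {0..pi} (unduloid_slice a y) = integral {0..pi} (unduloid_arclength_slice a y)"
proof -
  define b where "b = sqrt (a\<^sup>2 - y\<^sup>2)"
  define X where "X = (\<lambda>\<tau>. (a * cos \<tau> - y) / (a - y * cos \<tau>))"
  have b: "b > 0" "b * b = a * a - y * y"
    unfolding b_def using unduloid_waist_pos[OF y ya] by (simp_all add: power2_eq_square)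
  have "a > 0" using y ya by simp
  note D = unduloid_factors_pos(1)[OF y ya]
  \<comment> \<open>Yields both the bound on \<open>X\<close> that \<open>arccos\<close> requires
    and the root that appears in the derivative of \<open>arccos\<close>.\<close>
  have X2: "1 - (X \<tau>)\<^sup>2 = (b * sin \<tau> / (a - y * cos \<tau>))\<^sup>2" for \<tau>
  proof -
    have "(a - y * cos \<tau>)\<^sup>2 - (a * cos \<tau> - y)\<^sup>2 = (a * a - y * y) * (1 - (cos \<tau>)\<^sup>2)"
      by (simp add: power2_eq_square algebra_simps)
    also have "\<dots> = (b * sin \<tau>)\<^sup>2"
      by (simp add: power_mult_distrib sin_squared_eq power2_eq_square[of b] b(2))
    finally show ?thesis
      using D[of \<tau>] by (simp add: X_def power_divide diff_divide_distrib[symmetric] divide_simps)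
  qed
  have X_le: "- 1 \<le> X \<tau> \<and> X \<tau> \<le> 1" for \<tau>
  proof -
    have "(X \<tau>)\<^sup>2 \<le> 1" using X2[of \<tau>] zero_le_power2[of "b * sin \<tau> / (a - y * cos \<tau>)"] by linarith
    then show ?thesis by (simp add: abs_square_le_1 abs_le_iff)
  qed
  have ends: "X 0 = 1" "X pi = - 1"
    using y ya by (simp_all add: X_def field_simps)
  have contX: "continuous_on T X" for T
    unfolding X_def using D by (intro continuous_intros) (auto simp: less_imp_neq[symmetric])
  have deriv: "((\<lambda>\<tau>. arccos (X \<tau>)) has_real_derivative b / (a - y * cos \<tau>)) (at \<tau>)"
    if \<tau>: "0 < \<tau>" "\<tau> < pi" for \<tau>
  proof -
    have "sin \<tau> > 0" using \<tau> by (rule sin_gt_zero)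
    then have root: "sqrt (1 - (X \<tau>)\<^sup>2) = b * sin \<tau> / (a - y * cos \<tau>)"
      unfolding X2 using b D[of \<tau>] by (simp add: real_sqrt_abs)
    have "(b * sin \<tau> / (a - y * cos \<tau>))\<^sup>2 > 0"
      using \<open>sin \<tau> > 0\<close> b D[of \<tau>] by simp
    then have "(X \<tau>)\<^sup>2 < 1" using X2[of \<tau>] by linarith
    then have lt: "- 1 < X \<tau>" "X \<tau> < 1"
      by (auto simp: abs_square_less_1 abs_less_iff)
    have "(X has_real_derivative
        ((- a * sin \<tau>) * (a - y * cos \<tau>) - (a * cos \<tau> - y) * (y * sin \<tau>)) / ((a - y * cos \<tau>) * (a - y * cos \<tau>))) (at \<tau>)"
      unfolding X_def using D[of \<tau>] by (intro DERIV_divide) (auto intro!: derivative_eq_intros)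
    from DERIV_chain2[OF DERIV_arccos[OF lt] this]
    have "((\<lambda>\<tau>. arccos (X \<tau>)) has_real_derivative inverse (- (b * sin \<tau> / (a - y * cos \<tau>))) *
        (((- a * sin \<tau>) * (a - y * cos \<tau>) - (a * cos \<tau> - y) * (y * sin \<tau>)) / ((a - y * cos \<tau>) * (a - y * cos \<tau>)))) (at \<tau>)"
      unfolding root .
    moreover have "(- a * sin \<tau>) * (a - y * cos \<tau>) - (a * cos \<tau> - y) * (y * sin \<tau>) = - (b * b * sin \<tau>)"
      unfolding b(2) by (simp add: algebra_simps)
    moreover have "inverse (- (b * sin \<tau> / (a - y * cos \<tau>))) *
        (- (b * b * sin \<tau>) / ((a - y * cos \<tau>) * (a - y * cos \<tau>))) = b / (a - y * cos \<tau>)"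
    proof -
      have "inverse (- (b * s / d)) * (- (b * b * s) / (d * d)) = b / d" if "s > 0" "d > 0" for s d
        using b(1) that by (simp add: field_simps)
      then show ?thesis using D[of \<tau>] \<open>sin \<tau> > 0\<close> by blast
    qed
    ultimately show ?thesis by (simp only:)
  qed
  \<comment> \<open>The general substitution rule subtracts the integral over the reversed interval.
    Here the angle runs from 0 to pi, so the subtracted integral is over an empty interval.\<close>
  have "((\<lambda>\<tau>. (b / (a - y * cos \<tau>)) *\<^sub>R unduloid_slice a y (arccos (X \<tau>))) has_integral
      (integral {arccos (X 0)..arccos (X pi)} (unduloid_slice a y) -
       integral {arccos (X pi)..arccos (X 0)} (unduloid_slice a y))) {0..pi}"
  \<comment> \<open>The end points are exempted: there \<open>X\<close> is 1 or -1, where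
    \<open>arccos\<close> is not differentiable.\<close>
  proof (rule has_integral_substitution_general[where s = "{0, pi}" and c = 0 and d = pi])
    show "(\<lambda>\<tau>. arccos (X \<tau>)) ` {0..pi} \<subseteq> {0..pi}"
      using X_le by (auto intro!: arccos_lbound arccos_ubound)
    show "continuous_on {0..pi} (\<lambda>\<tau>. arccos (X \<tau>))"
      using X_le by (intro continuous_on_arccos contX) auto
    show "finite {0, pi}" by simp
    fix \<tau> assume "\<tau> \<in> {0..pi} - {0, pi}"
    then show "((\<lambda>\<tau>. arccos (X \<tau>)) has_real_derivative b / (a - y * cos \<tau>)) (at \<tau> within {0..pi})"
      by (intro has_field_derivative_at_within[OF deriv]) auto
  qed (auto intro: continuous_on_unduloid_slice)
  moreover have "(b / (a - y * cos \<tau>)) *\<^sub>R unduloid_slice a y (arccos (X \<tau>)) = unduloid_arclength_slice a y \<tau>" for \<tau>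
  proof -
    \<comment> \<open>The distance to the axis in the new parameter: b R / (a + y X) reduces to
      \<open>F\<close>, a law-of-cosines expression with no denominator that could vanish as y tends
      to a.\<close>
    define F where "F = sqrt (a\<^sup>2 + y\<^sup>2 - 2 * a * y * cos \<tau>)"
    define d where "d = a - y * cos \<tau>"
    have d: "d > 0" unfolding d_def by (rule D)
    have "a\<^sup>2 + y\<^sup>2 - 2 * a * y * cos \<tau> = (a - y * cos \<tau>)\<^sup>2 + y\<^sup>2 * (1 - (cos \<tau>)\<^sup>2)"
      by (simp add: power2_eq_square algebra_simps)
    also have "\<dots> > 0"
      using d by (intro add_pos_nonneg mult_nonneg_nonneg) (simp_all add: d_def abs_square_le_1)
    finally have F: "F > 0" "F * F = a\<^sup>2 + y\<^sup>2 - 2 * a * y * cos \<tau>"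
      unfolding F_def by simp_all
    have cosX: "cos (arccos (X \<tau>)) = X \<tau>"
      using X_le by (simp add: cos_arccos)
    have plus: "a + y * X \<tau> = b * b / d"
      unfolding b(2) X_def using d by (simp add: d_def field_simps)
    have minus: "a - y * X \<tau> = F * F / d"
      unfolding F(2) X_def using d by (simp add: d_def field_simps power2_eq_square)
    have root: "sqrt (a\<^sup>2 - y\<^sup>2 * (X \<tau>)\<^sup>2) = b * F / d"
    proof (rule real_sqrt_unique)
      have "a\<^sup>2 - y\<^sup>2 * (X \<tau>)\<^sup>2 = (a + y * X \<tau>) * (a - y * X \<tau>)"
        by (simp add: power2_eq_square algebra_simps)
      also have "\<dots> = (b * F / d)\<^sup>2"
        unfolding plus minus by (simp add: power2_eq_square)
      finally show "(b * F / d)\<^sup>2 = a\<^sup>2 - y\<^sup>2 * (X \<tau>)\<^sup>2" by simp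
    qed (use b d F in simp)
    have "b / d * unduloid_slice a y (arccos (X \<tau>)) =
        b / d * ((b * (b * F / d / (b * b / d)))\<^sup>2 * (a * b / (b * b / d) * (b / (b * F / d))))"
      unfolding unduloid_slice_def unduloid_altdef[OF y ya] fst_conv cosX plus root
      by (simp add: b_def)
    also have "\<dots> = a * d * F"
      using b(1) d F(1) by (simp add: field_simps power2_eq_square)
    finally show ?thesis
      by (simp add: unduloid_arclength_slice_def F_def d_def)
  qed
  ultimately have "(unduloid_arclength_slice a y has_integral integral {0..pi} (unduloid_slice a y)) {0..pi}"
    by (simp add: ends)
  then show ?thesis by (simp add: integral_unique)
qed

end

section \<open>The limit case\<close>

lemma has_integral_antiderivative:
  fixes F :: "real \<Rightarrow> real"
  assumes "a \<le> b" "\<And>x. a \<le> x \<Longrightarrow> x \<le> b \<Longrightarrow> \<phi> x = D x"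
    and "\<And>x. (F has_real_derivative D x) (at x)"
  shows "(\<phi> has_integral F b - F a) {a..b}"
proof -
  have "(D has_integral F b - F a) {a..b}"
    using has_field_derivative_at_within[OF assms(3)]
    by (intro fundamental_theorem_of_calculus[OF assms(1)])
      (auto simp flip: has_real_derivative_iff_has_vector_derivative)
  then show ?thesis
    by (rule has_integral_eq[rotated]) (use assms(2) in auto)
qed

text \<open>The set \<open>U\<close> allows a one-sided limit in c, with \<open>U\<close> =
  \<open>{1..}\<close>, as well as a limit of the pair (a, y) at (1, 1).\<close>

lemma tendsto_integral_parametric:
  fixes \<phi> :: "'a::topological_space \<Rightarrow> real \<Rightarrow> real"
  assumes "continuous_on (U \<times> {a..b}) (\<lambda>(x, t). \<phi> x t)"
    and "(P \<longlongrightarrow> p) F" "p \<in> U" "eventually (\<lambda>c. P c \<in> U) F"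
  shows "((\<lambda>c. integral {a..b} (\<phi> (P c))) \<longlongrightarrow> integral {a..b} (\<phi> p)) F"
proof -
  have "continuous_on U (\<lambda>x. integral (cbox a b) (\<phi> x))"
    by (rule integral_continuous_on_param) (use assms(1) in simp)
  from continuous_on_tendsto_compose[OF this assms(2-4)] show ?thesis by simp
qed

text \<open>Where \<open>c = 1\<close> and \<open>cos s = 0\<close> the quotient is \<open>0 / 0 = 0\<close>, which is its continuous extension.\<close>

lemma continuous_on_nodoid_quotient:
  "continuous_on ({1..} \<times> UNIV) (\<lambda>(c :: real, s). (cos s)\<^sup>2 / sqrt (c\<^sup>2 - (sin s)\<^sup>2))"
  unfolding continuous_on_def case_prod_unfold
proof
  let ?m = "\<lambda>z :: real \<times> real. (cos (snd z))\<^sup>2 / sqrt ((fst z)\<^sup>2 - (sin (snd z))\<^sup>2)"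
  fix z :: "real \<times> real" assume z: "z \<in> {1..} \<times> UNIV"
  \<comment> \<open>This bounds the root below by the absolute value of cos, and hence the quotient
    above by the same quantity, which tends to 0 at the singular points.\<close>
  have ge: "(cos s)\<^sup>2 \<le> c\<^sup>2 - (sin s)\<^sup>2" if "c \<ge> 1" for c s :: real
    using that by (simp add: cos_squared_eq)
  show "(?m \<longlongrightarrow> ?m z) (at z within {1..} \<times> UNIV)"
  proof (cases "(fst z)\<^sup>2 - (sin (snd z))\<^sup>2 = 0")
    case False
    then show ?thesis by (intro tendsto_intros) auto
  next
    case True
    then have "(cos (snd z))\<^sup>2 \<le> 0" using ge[of "fst z" "snd z"] z by auto
    then have cos0: "cos (snd z) = 0" by simp
    have "((\<lambda>z. \<bar>cos (snd z)\<bar>) \<longlongrightarrow> \<bar>cos (snd z)\<bar>) (at z within {1..} \<times> UNIV)"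
      by (intro tendsto_intros)
    then have lim: "((\<lambda>z. \<bar>cos (snd z)\<bar>) \<longlongrightarrow> 0) (at z within {1..} \<times> UNIV)"
      by (simp add: cos0)
    have le: "norm (?m w) \<le> \<bar>cos (snd w)\<bar>" if "w \<in> {1..} \<times> UNIV" for w
    proof -
      have root: "\<bar>cos (snd w)\<bar> \<le> sqrt ((fst w)\<^sup>2 - (sin (snd w))\<^sup>2)"
        using ge[of "fst w" "snd w"] that by (metis mem_Times_iff atLeast_iff real_sqrt_abs real_sqrt_le_mono)
      have "(cos (snd w))\<^sup>2 = \<bar>cos (snd w)\<bar> * \<bar>cos (snd w)\<bar>"
        by (simp add: power2_eq_square)
      also have "\<dots> \<le> \<bar>cos (snd w)\<bar> * sqrt ((fst w)\<^sup>2 - (sin (snd w))\<^sup>2)"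
        by (intro mult_left_mono root) simp
      finally show ?thesis
        using root abs_ge_zero[of "cos (snd w)"]
        by (cases "sqrt ((fst w)\<^sup>2 - (sin (snd w))\<^sup>2) = 0") (auto simp: pos_divide_le_eq)
    qed
    have "(?m \<longlongrightarrow> 0) (at z within {1..} \<times> UNIV)"
      by (rule Lim_null_comparison[OF _ lim]) (use le in \<open>auto simp: eventually_at_filter\<close>)
    then show ?thesis by (simp add: cos0)
  qed
qed

section \<open>Exact values of the arc integrals in the limit case\<close>

lemma sqrt_one_minus_sin_squared: "sqrt (1 - (sin s)\<^sup>2) = \<bar>cos s\<bar>" for s :: real
  by (simp flip: cos_squared_eq)

lemma cos_squared_div_abs_cos: "(cos s)\<^sup>2 / \<bar>cos s\<bar> = \<bar>cos s\<bar>" for s :: real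
  by (simp add: abs_if power2_eq_square)

lemma continuous_on_nodoid_slice: "continuous_on ({1..} \<times> T) (\<lambda>(c, s). nodoid_slice c s)"
proof -
  have quotient: "continuous_on ({1..} \<times> T) (\<lambda>z. (cos (snd z))\<^sup>2 / sqrt ((fst z)\<^sup>2 - (sin (snd z))\<^sup>2))"
    using continuous_on_subset[OF continuous_on_nodoid_quotient, of "{1..} \<times> T"]
    by (auto simp: case_prod_unfold)
  show ?thesis
    unfolding nodoid_slice_def case_prod_unfold
    by (intro continuous_on_mult continuous_on_diff quotient) (intro continuous_intros)+
qed

lemma cos_nonpos: "pi / 2 \<le> s \<Longrightarrow> s \<le> 3 * pi / 2 \<Longrightarrow> cos s \<le> 0"
  using cos_ge_zero[of "s - pi"] by simp

lemma cos_nonneg_last_quarter: "3 * pi / 2 \<le> s \<Longrightarrow> s \<le> 2 * pi \<Longrightarrow> 0 \<le> cos s"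
  using cos_ge_zero[of "s - 2 * pi"] by (simp add: cos_diff)

text \<open>For c = 1 the radius is |cos s| - cos s. It is -2 cos s on [pi, 3 pi / 2], a quarter
  circle of radius 2, and zero on the last quarter, which collapses to a point of the axis. The
  value is minus the volume of a half ball of radius 2, divided by pi; the sign comes from the
  decreasing height.\<close>

lemma integral_nodoid_slice_1: "integral {pi..2 * pi} (nodoid_slice 1) = - 16 / 3"
proof -
  have slice: "nodoid_slice 1 s = (\<bar>cos s\<bar> - cos s)\<^sup>2 * (cos s - \<bar>cos s\<bar>)" for s
    by (simp add: nodoid_slice_def sqrt_one_minus_sin_squared cos_squared_div_abs_cos)
  have "(nodoid_slice 1 has_integral
      8 * (sin (3 * pi / 2) - (sin (3 * pi / 2)) ^ 3 / 3) - 8 * (sin pi - (sin pi) ^ 3 / 3)) {pi..3 * pi / 2}"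
  proof (rule has_integral_antiderivative)
    fix s :: real assume "pi \<le> s" "s \<le> 3 * pi / 2"
    then have "cos s \<le> 0" using pi_gt_zero by (intro cos_nonpos) linarith+
    then have "nodoid_slice 1 s = 8 * (cos s * (cos s)\<^sup>2)"
      by (simp add: slice power2_eq_square)
    then show "nodoid_slice 1 s = 8 * (cos s * (1 - (sin s)\<^sup>2))"
      by (simp only: cos_squared_eq)
  next
    show "((\<lambda>s. 8 * (sin s - (sin s) ^ 3 / 3)) has_real_derivative 8 * (cos s * (1 - (sin s)\<^sup>2))) (at s)" for s :: real
      by (auto intro!: derivative_eq_intros simp: algebra_simps)
  qed simp
  moreover have "(nodoid_slice 1 has_integral 0 - 0) {3 * pi / 2..2 * pi}"
    by (rule has_integral_antiderivative) (auto simp: slice cos_nonneg_last_quarter)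
  moreover have "sin (3 * pi / 2) = - 1"
    using sin_3over2_pi by (simp add: mult.commute)
  ultimately have "(nodoid_slice 1 has_integral - 16 / 3) {pi..2 * pi}"
    using has_integral_combine[of pi "3 * pi / 2" "2 * pi" "nodoid_slice 1"] by fastforce
  then show ?thesis by (rule integral_unique)
qed

text \<open>Only [pi/2, pi] contributes: the arc descends by the radius 2 there and is collapsed
  before. The unsimplified \<open>1\<^sup>2\<close> matches the instance c = 1 of the parametric
  integral.\<close>

lemma integral_nodoid_height_1: "integral {0..pi} (\<lambda>s. cos s - (cos s)\<^sup>2 / sqrt (1\<^sup>2 - (sin s)\<^sup>2)) = - 2"
proof -
  let ?\<phi> = "\<lambda>s. cos s - \<bar>cos s\<bar> :: real"
  have "(?\<phi> has_integral 0 - 0) {0..pi / 2}"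
    by (rule has_integral_antiderivative) (auto simp: cos_ge_zero)
  moreover have "(?\<phi> has_integral 2 * sin pi - 2 * sin (pi / 2)) {pi / 2..pi}"
    by (rule has_integral_antiderivative[where D = "\<lambda>s. 2 * cos s"])
      (auto intro!: derivative_eq_intros simp: abs_of_nonpos cos_nonpos)
  ultimately have "(?\<phi> has_integral - 2) {0..pi}"
    using has_integral_combine[of 0 "pi / 2" pi ?\<phi>] by fastforce
  then show ?thesis by (simp add: sqrt_one_minus_sin_squared cos_squared_div_abs_cos integral_unique)
qed

text \<open>Half angles turn the root into 2 sin (\<open>\<tau>\<close> / 2) and the slice into 4
  sin^3 (\<open>\<tau>\<close> / 2). The value is again a half ball of radius 2 over pi, now with
  increasing height.\<close>

lemma integral_unduloid_arclength_slice_1: "integral {0..pi} (unduloid_arclength_slice 1 1) = 16 / 3"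
proof -
  have "(unduloid_arclength_slice 1 1 has_integral
      (- 8 * cos (pi / 2) + 8 / 3 * (cos (pi / 2)) ^ 3) - (- 8 * cos (0 / 2) + 8 / 3 * (cos (0 / 2)) ^ 3)) {0..pi}"
  proof (rule has_integral_antiderivative)
    fix \<tau> :: real assume \<tau>: "0 \<le> \<tau>" "\<tau> \<le> pi"
    have c: "cos \<tau> = 1 - 2 * (sin (\<tau> / 2))\<^sup>2"
      using cos_double_sin[of "\<tau> / 2"] by simp
    have "sin (\<tau> / 2) \<ge> 0" using \<tau> by (intro sin_ge_zero) auto
    then have "sqrt (1\<^sup>2 + 1\<^sup>2 - 2 * 1 * 1 * cos \<tau>) = 2 * sin (\<tau> / 2)"
      by (intro real_sqrt_unique) (simp_all add: c power_mult_distrib)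
    then have "unduloid_arclength_slice 1 1 \<tau> = 4 * sin (\<tau> / 2) * (sin (\<tau> / 2))\<^sup>2"
      by (simp add: unduloid_arclength_slice_def c)
    then show "unduloid_arclength_slice 1 1 \<tau> = 4 * sin (\<tau> / 2) * (1 - (cos (\<tau> / 2))\<^sup>2)"
      by (simp only: sin_squared_eq)
  next
    show "((\<lambda>\<tau>. - 8 * cos (\<tau> / 2) + 8 / 3 * (cos (\<tau> / 2)) ^ 3) has_real_derivative
        4 * sin (\<tau> / 2) * (1 - (cos (\<tau> / 2))\<^sup>2)) (at \<tau>)" for \<tau> :: real
      by (auto intro!: derivative_eq_intros simp: algebra_simps)
  qed simp
  then show ?thesis by (simp add: integral_unique)
qed

lemma integral_unduloid_height_1: "integral {0..pi} (\<lambda>x. sqrt (1\<^sup>2 - 1\<^sup>2 * (cos x)\<^sup>2)) = 2"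
proof -
  have "((\<lambda>x. sqrt (1\<^sup>2 - 1\<^sup>2 * (cos x)\<^sup>2)) has_integral - cos pi - - cos 0) {0..pi}"
    by (rule has_integral_antiderivative[where D = sin])
      (auto intro!: derivative_eq_intros simp: sin_ge_zero simp flip: sin_squared_eq)
  then show ?thesis by (simp add: integral_unique)
qed

text \<open>Under one integral sign the numerator c^2 - sin^2 s - (c^2 - 1) collapses to cos^2 s.
  The divergence of K at modulus 1 disappears, since the quotient is at most |cos s|.\<close>

lemma delaunay_L_integral:
  assumes "delaunay_torus_exists c"
  shows "delaunay_L c = 4 * integral {0..pi / 2} (\<lambda>s. (cos s)\<^sup>2 / sqrt (c\<^sup>2 - (sin s)\<^sup>2))"
proof -
  note D = delaunayD[OF assms]
  define w where "w = (\<lambda>s. 1 - (1 / c)\<^sup>2 * (sin s)\<^sup>2)"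
  have cw: "c\<^sup>2 * w s = c\<^sup>2 - (sin s)\<^sup>2" for s
    using D(1) by (simp add: w_def power_divide right_diff_distrib)
  have wpos: "w s > 0" for s
    using nodoid_radicand_pos[OF D(1), of s] D(1) by (simp add: zero_less_mult_iff flip: cw)
  have contE: "continuous_on {0..pi / 2} (\<lambda>s. sqrt (w s))"
    unfolding w_def by (intro continuous_intros)
  have contK: "continuous_on {0..pi / 2} (\<lambda>s. 1 / sqrt (w s))"
    using wpos by (intro continuous_intros contE) (auto simp: less_imp_neq[symmetric])
  have E: "elliptic_E (1 / c) = integral {0..pi / 2} (\<lambda>s. sqrt (w s))"
    and K: "elliptic_K (1 / c) = integral {0..pi / 2} (\<lambda>s. 1 / sqrt (w s))"
    by (simp_all add: elliptic_E_def elliptic_K_def w_def)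
  have "c * (elliptic_E (1 / c) - (1 - 1 / c\<^sup>2) * elliptic_K (1 / c)) =
      integral {0..pi / 2} (\<lambda>s. c * (sqrt (w s) - (1 - 1 / c\<^sup>2) * (1 / sqrt (w s))))"
    unfolding E K
    by (intro integral_unique[symmetric] has_integral_mult_right has_integral_diff integrable_integral
        integrable_continuous_real contE contK)
  also have "\<dots> = integral {0..pi / 2} (\<lambda>s. (cos s)\<^sup>2 / sqrt (c\<^sup>2 - (sin s)\<^sup>2))"
  proof (rule integral_cong)
    fix s
    have root: "sqrt (c\<^sup>2 - (sin s)\<^sup>2) = c * sqrt (w s)"
      unfolding cw[symmetric] real_sqrt_mult using D(1) by simp
    have "c * (sqrt (w s) - (1 - 1 / c\<^sup>2) * (1 / sqrt (w s))) = (c\<^sup>2 * (sqrt (w s))\<^sup>2 - (c\<^sup>2 - 1)) / (c * sqrt (w s))"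
      using D(1) wpos[of s] by (simp add: divide_simps) (simp add: power2_eq_square algebra_simps)
    also have "c\<^sup>2 * (sqrt (w s))\<^sup>2 - (c\<^sup>2 - 1) = (cos s)\<^sup>2"
      using wpos[of s] by (simp add: cw cos_squared_eq)
    finally show "c * (sqrt (w s) - (1 - 1 / c\<^sup>2) * (1 / sqrt (w s))) = (cos s)\<^sup>2 / sqrt (c\<^sup>2 - (sin s)\<^sup>2)"
      by (simp only: root)
  qed
  finally show ?thesis using D(5) by simp
qed

text \<open>With b^2 = a^2 - y^2, the radicand of a E(y/a) is (a cos)^2 + (b sin)^2 and also (y
  cos)^2 + b^2. The first form bounds the root below by a cos, the second above by a cos + b; both
  bounds integrate explicitly.\<close>

lemma delaunay_L_bounds:
  assumes "delaunay_torus_exists c"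
  shows "delaunay_a c \<le> delaunay_L c / 4"
    and "delaunay_L c / 4 \<le> delaunay_a c + pi / 2 * sqrt ((delaunay_a c)\<^sup>2 - (delaunay_y c)\<^sup>2)"
proof -
  define a y where "a = delaunay_a c" and "y = delaunay_y c"
  note D = delaunayD[OF assms, folded a_def y_def]
  define b where "b = sqrt (a\<^sup>2 - y\<^sup>2)"
  have b: "b \<ge> 0" "b\<^sup>2 = a\<^sup>2 - y\<^sup>2"
    using unduloid_waist_pos[OF D(2,3)] by (simp_all add: b_def)
  have L: "delaunay_L c / 4 = integral {0..pi / 2} (\<lambda>\<theta>. a * sqrt (1 - (y / a)\<^sup>2 * (sin \<theta>)\<^sup>2))"
    unfolding delaunay_L_def elliptic_E_def a_def y_def by simp
  have root: "a * sqrt (1 - (y / a)\<^sup>2 * (sin \<theta>)\<^sup>2) = sqrt (a\<^sup>2 - y\<^sup>2 * (sin \<theta>)\<^sup>2)" for \<theta>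
  proof -
    have "a * sqrt (1 - (y / a)\<^sup>2 * (sin \<theta>)\<^sup>2) = sqrt (a\<^sup>2 * (1 - (y / a)\<^sup>2 * (sin \<theta>)\<^sup>2))"
      unfolding real_sqrt_mult using D by simp
    also have "a\<^sup>2 * (1 - (y / a)\<^sup>2 * (sin \<theta>)\<^sup>2) = a\<^sup>2 - y\<^sup>2 * (sin \<theta>)\<^sup>2"
      using D by (simp add: power_divide right_diff_distrib)
    finally show ?thesis .
  qed
  have eq: "a\<^sup>2 - y\<^sup>2 * (sin \<theta>)\<^sup>2 = (y * cos \<theta>)\<^sup>2 + b\<^sup>2" for \<theta>
    by (simp add: b(2) cos_squared_eq power_mult_distrib right_diff_distrib)
  have eq': "(y * cos \<theta>)\<^sup>2 + b\<^sup>2 = (a * cos \<theta>)\<^sup>2 + (b * sin \<theta>)\<^sup>2" for \<theta>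
    by (simp add: b(2) cos_squared_eq power_mult_distrib algebra_simps)
  have int: "(\<lambda>\<theta>. a * sqrt (1 - (y / a)\<^sup>2 * (sin \<theta>)\<^sup>2)) integrable_on {0..pi / 2}"
    by (intro integrable_continuous_real continuous_intros)
  have low: "a * cos \<theta> \<le> a * sqrt (1 - (y / a)\<^sup>2 * (sin \<theta>)\<^sup>2)" for \<theta>
    unfolding root eq eq' by (rule real_le_rsqrt) simp
  have up: "a * sqrt (1 - (y / a)\<^sup>2 * (sin \<theta>)\<^sup>2) \<le> a * cos \<theta> + b" if "\<theta> \<in> {0..pi / 2}" for \<theta>
  proof -
    have c: "cos \<theta> \<ge> 0" using that by (intro cos_ge_zero) auto
    have "sqrt ((y * cos \<theta>)\<^sup>2 + b\<^sup>2) \<le> y * cos \<theta> + b"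
      using c b(1) D by (intro sqrt_sum_squares_le_sum) auto
    also have "y * cos \<theta> \<le> a * cos \<theta>"
      using c D by (intro mult_right_mono) auto
    finally show ?thesis unfolding root eq by simp
  qed
  have "integral {0..pi / 2} (\<lambda>\<theta>. a * cos \<theta>) \<le> delaunay_L c / 4"
    unfolding L using int low by (intro integral_le integrable_continuous_real continuous_intros) auto
  then show "a \<le> delaunay_L c / 4"
    by (simp add: integral_cos_quarter)
  have "delaunay_L c / 4 \<le> integral {0..pi / 2} (\<lambda>\<theta>. a * cos \<theta> + b)"
    unfolding L using int up by (intro integral_le integrable_continuous_real continuous_intros) auto
  also have "\<dots> = integral {0..pi / 2} (\<lambda>\<theta>. a * cos \<theta>) + integral {0..pi / 2} (\<lambda>\<theta>. b)"
    by (intro Henstock_Kurzweil_Integration.integral_add integrable_continuous_real continuous_intros)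
  also have "\<dots> = a + pi / 2 * b"
    by (simp add: integral_cos_quarter)
  finally show "delaunay_L c / 4 \<le> a + pi / 2 * sqrt (a\<^sup>2 - y\<^sup>2)"
    by (simp add: b_def)
qed

section \<open>The isoperimetric ratio\<close>

lemma integral_cap_volume:
  "integral {0..pi / 2} (\<lambda>t. \<rho>\<^sup>2 * sin t * (h * cos t + \<rho>)) = \<rho>\<^sup>2 * h / 2 + \<rho> ^ 3"
  "integral {0..pi / 2} (\<lambda>t. \<rho>\<^sup>2 * cos t * - (h * sin t + \<rho>)) = - (\<rho>\<^sup>2 * h / 2 + \<rho> ^ 3)"
proof -
  have "((\<lambda>t. \<rho>\<^sup>2 * sin t * (h * cos t + \<rho>)) has_integral
      \<rho>\<^sup>2 * (h * (sin (pi / 2))\<^sup>2 / 2 - \<rho> * cos (pi / 2)) - \<rho>\<^sup>2 * (h * (sin 0)\<^sup>2 / 2 - \<rho> * cos 0)) {0..pi / 2}"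
    by (rule has_integral_antiderivative[OF _ refl])
      (auto intro!: derivative_eq_intros simp: algebra_simps)
  then show "integral {0..pi / 2} (\<lambda>t. \<rho>\<^sup>2 * sin t * (h * cos t + \<rho>)) = \<rho>\<^sup>2 * h / 2 + \<rho> ^ 3"
    by (simp add: integral_unique power3_eq_cube power2_eq_square)
  have "((\<lambda>t. \<rho>\<^sup>2 * cos t * - (h * sin t + \<rho>)) has_integral
      - \<rho>\<^sup>2 * (h * (sin (pi / 2))\<^sup>2 / 2 + \<rho> * sin (pi / 2)) - - \<rho>\<^sup>2 * (h * (sin 0)\<^sup>2 / 2 + \<rho> * sin 0)) {0..pi / 2}"
    by (rule has_integral_antiderivative[OF _ refl])
      (auto intro!: derivative_eq_intros simp: algebra_simps)
  then show "integral {0..pi / 2} (\<lambda>t. \<rho>\<^sup>2 * cos t * - (h * sin t + \<rho>)) = - (\<rho>\<^sup>2 * h / 2 + \<rho> ^ 3)"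
    by (simp add: integral_unique power3_eq_cube power2_eq_square algebra_simps)
qed

text \<open>Three times the volume for orientation 1, in the order cap, nodoid, unduloid, cap. All
  terms have limits as c tends to 1, because the unduloid slice is already in arc length.\<close>

definition delaunay_sphere_support_integral :: "real \<Rightarrow> real"
  where "delaunay_sphere_support_integral c =
    (let a = delaunay_a c; y = delaunay_y c; L = delaunay_L c in
    2 * pi * (((c + 1)\<^sup>2 * (L / 2) / 2 + (c + 1) ^ 3) +
      ((c - 1)\<^sup>2 * snd (nodoid c L (2 * pi)) / 2 - (c + 1)\<^sup>2 * snd (nodoid c L pi) / 2
        - 3 / 2 * integral {pi..2 * pi} (nodoid_slice c)) +
      ((a + y)\<^sup>2 * snd (unduloid a y pi) / 2 - (a - y)\<^sup>2 * snd (unduloid a y 0) / 2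
        - 3 / 2 * integral {0..pi} (unduloid_arclength_slice a y)) -
      ((a + y)\<^sup>2 * (L / 2) / 2 + (a + y) ^ 3)))"

lemma surface_vol_delaunay_sphere:
  assumes ex: "delaunay_torus_exists c"
  shows "surface_vol (delaunay_sphere c) = \<bar>delaunay_sphere_support_integral c\<bar> / 3"
proof -
  note D = delaunayD[OF ex]
  have "surface_vol (delaunay_sphere c) = \<bar>2 * pi * integral {0..pi / 2} (\<lambda>t. (c + 1)\<^sup>2 * sin t * (delaunay_L c / 2 * cos t + (c + 1))) +
      (2 * pi * integral {pi..2 * pi} (\<lambda>s. nodoid_area c (delaunay_L c) s * nodoid_support c (delaunay_L c) s) +
      (2 * pi * integral {0..pi} (\<lambda>t. unduloid_area (delaunay_a c) (delaunay_y c) t * unduloid_support (delaunay_a c) (delaunay_y c) t) +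
      2 * pi * integral {0..pi / 2} (\<lambda>t. (delaunay_a c + delaunay_y c)\<^sup>2 * cos t * - (delaunay_L c / 2 * sin t + (delaunay_a c + delaunay_y c)))))\<bar> / 3"
    unfolding delaunay_sphere_def
    by (rule surface_of_revolution_functionals(3), rule delaunay_sphere_functionals[OF ex])
  then show ?thesis
    unfolding integral_cap_volume nodoid_volume[OF D(1)] unduloid_volume[OF D(2,3)]
      integral_unduloid_slice[OF D(2,3)] delaunay_sphere_support_integral_def Let_def
    by (simp add: distrib_left right_diff_distrib)
qed

lemma surface_area_delaunay_sphere_ge:
  assumes ex: "delaunay_torus_exists c"
  shows "2 * pi * (c + 1)\<^sup>2 \<le> surface_area (delaunay_sphere c)"
proof -
  define a y L where "a = delaunay_a c" and "y = delaunay_y c" and "L = delaunay_L c"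
  note D = delaunayD[OF ex, folded a_def y_def L_def]
  have area: "surface_area (delaunay_sphere c) =
    2 * pi * integral {0..pi / 2} (\<lambda>t. (c + 1)\<^sup>2 * sin t) +
      (2 * pi * integral {pi..2 * pi} (nodoid_area c L) +
      (2 * pi * integral {0..pi} (unduloid_area a y) +
      2 * pi * integral {0..pi / 2} (\<lambda>t. (a + y)\<^sup>2 * cos t)))"
    unfolding delaunay_sphere_def
    by (rule surface_of_revolution_functionals(2),
        rule delaunay_sphere_functionals[OF ex, folded a_def y_def L_def])
  have "0 \<le> integral {pi..2 * pi} (nodoid_area c L)"
  proof (rule Henstock_Kurzweil_Integration.integral_nonneg)
    show "nodoid_area c L integrable_on {pi..2 * pi}"
      by (intro integrable_continuous_real arc_densitiesD(2)[OF arc_densities_nodoid[OF D(1)]]) simp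
    show "0 \<le> nodoid_area c L s" for s
      using nodoid_radicand_pos[OF D(1), of s] by (simp add: nodoid_area_def)
  qed
  moreover have "0 \<le> integral {0..pi} (unduloid_area a y)"
  proof (rule Henstock_Kurzweil_Integration.integral_nonneg)
    show "unduloid_area a y integrable_on {0..pi}"
      by (intro integrable_continuous_real arc_densitiesD(2)[OF arc_densities_unduloid[OF D(2,3)]]) simp
    show "0 \<le> unduloid_area a y t" for t
      using fst_unduloid_pos[OF D(2,3), of t] unduloid_factors_pos(2)[OF D(2,3), of t]
        unduloid_waist_pos[OF D(2,3)] D(2,3) by (simp add: unduloid_area_def)
  qed
  ultimately show ?thesis
    unfolding area by (simp add: integral_sin_quarter integral_cos_quarter)
qed

text \<open>The nodoid side of the system determines the limit of L, the unduloid side then squeezes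
  \<open>a\<close>, and \<open>y\<close> follows from a - y = c - 1.\<close>

lemma delaunay_parameter_limits:
  assumes ex: "eventually delaunay_torus_exists (at_right 1)"
  shows "(delaunay_L \<longlongrightarrow> 4) (at_right 1)"
    and "(delaunay_a \<longlongrightarrow> 1) (at_right 1)"
    and "(delaunay_y \<longlongrightarrow> 1) (at_right 1)"
proof -
  have quotient: "continuous_on ({1..} \<times> {0..pi / 2}) (\<lambda>(c :: real, s). (cos s)\<^sup>2 / sqrt (c\<^sup>2 - (sin s)\<^sup>2))"
    using continuous_on_nodoid_quotient by (rule continuous_on_subset) auto
  have ge1: "eventually (\<lambda>c :: real. c \<in> {1..}) (at_right 1)"
    by (auto simp: eventually_at_filter)
  have id: "((\<lambda>c. c) \<longlongrightarrow> (1 :: real)) (at_right 1)"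
    by (rule tendsto_ident_at)
  have "((\<lambda>c. integral {0..pi / 2} (\<lambda>s. (cos s)\<^sup>2 / sqrt (c\<^sup>2 - (sin s)\<^sup>2))) \<longlongrightarrow>
      integral {0..pi / 2} (\<lambda>s. (cos s)\<^sup>2 / sqrt (1\<^sup>2 - (sin s)\<^sup>2))) (at_right 1)"
    by (rule tendsto_integral_parametric[OF quotient id _ ge1]) simp
  moreover have "integral {0..pi / 2} (\<lambda>s. (cos s)\<^sup>2 / sqrt (1\<^sup>2 - (sin s)\<^sup>2)) = integral {0..pi / 2} cos"
    by (rule integral_cong)
      (simp only: one_power2 sqrt_one_minus_sin_squared cos_squared_div_abs_cos, simp add: cos_ge_zero)
  ultimately have "((\<lambda>c. 4 * integral {0..pi / 2} (\<lambda>s. (cos s)\<^sup>2 / sqrt (c\<^sup>2 - (sin s)\<^sup>2))) \<longlongrightarrow> 4 * 1) (at_right 1)"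
    by (intro tendsto_mult_left) (simp add: integral_cos_quarter)
  moreover have "eventually (\<lambda>c. 4 * integral {0..pi / 2} (\<lambda>s. (cos s)\<^sup>2 / sqrt (c\<^sup>2 - (sin s)\<^sup>2)) = delaunay_L c) (at_right 1)"
    using ex by eventually_elim (simp add: delaunay_L_integral)
  ultimately show L: "(delaunay_L \<longlongrightarrow> 4) (at_right 1)"
    by (simp add: tendsto_cong)
  have up: "((\<lambda>c. delaunay_L c / 4) \<longlongrightarrow> 1) (at_right 1)"
    using tendsto_divide[OF L tendsto_const[of 4]] by simp
  \<comment> \<open>The root bounds b from above: b^2 = (a + y)(c - 1), and y < a with a at most
    L/4.\<close>
  have "((\<lambda>c. delaunay_L c / 4 - pi / 2 * sqrt (2 * (delaunay_L c / 4) * (c - 1))) \<longlongrightarrow>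
      1 - pi / 2 * sqrt (2 * 1 * (1 - 1))) (at_right 1)"
    by (intro tendsto_intros up)
  then have low: "((\<lambda>c. delaunay_L c / 4 - pi / 2 * sqrt (2 * (delaunay_L c / 4) * (c - 1))) \<longlongrightarrow> 1) (at_right 1)"
    by simp
  show a: "(delaunay_a \<longlongrightarrow> 1) (at_right 1)"
  proof (rule tendsto_sandwich[OF _ _ low up])
    show "eventually (\<lambda>c. delaunay_a c \<le> delaunay_L c / 4) (at_right 1)"
      using ex by eventually_elim (rule delaunay_L_bounds)
    show "eventually (\<lambda>c. delaunay_L c / 4 - pi / 2 * sqrt (2 * (delaunay_L c / 4) * (c - 1)) \<le> delaunay_a c) (at_right 1)"
      using ex
    proof eventually_elim
      case (elim c)
      note D = delaunayD[OF elim] and B = delaunay_L_bounds[OF elim]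
      have "(delaunay_a c)\<^sup>2 - (delaunay_y c)\<^sup>2 = (delaunay_a c + delaunay_y c) * (c - 1)"
        unfolding D(4)[symmetric] by (simp add: power2_eq_square algebra_simps)
      also have "\<dots> \<le> 2 * (delaunay_L c / 4) * (c - 1)"
        using D(1,3) B(1) by (intro mult_right_mono) auto
      finally have "pi / 2 * sqrt ((delaunay_a c)\<^sup>2 - (delaunay_y c)\<^sup>2) \<le>
          pi / 2 * sqrt (2 * (delaunay_L c / 4) * (c - 1))"
        by (intro mult_left_mono real_sqrt_le_mono) auto
      then show ?case using B(2) by linarith
    qed
  qed
  have "((\<lambda>c. delaunay_a c - (c - 1)) \<longlongrightarrow> 1 - (1 - 1)) (at_right 1)"
    by (intro tendsto_intros a)
  moreover have "eventually (\<lambda>c. delaunay_a c - (c - 1) = delaunay_y c) (at_right 1)"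
    using ex
  proof eventually_elim
    case (elim c)
    then show ?case using delaunayD(4)[OF elim] by simp
  qed
  ultimately show "(delaunay_y \<longlongrightarrow> 1) (at_right 1)"
    by (simp add: tendsto_cong)
qed

text \<open>
  As \<open>c\<close> tends to \<open>1\<close>, both caps and both arcs tend to quarters of one circle of radius \<open>2\<close>; the
  limit is that sphere, covered twice with opposite orientations.
\<close>

lemma delaunay_sphere_support_integral_limit:
  assumes ex: "eventually delaunay_torus_exists (at_right 1)"
  shows "(delaunay_sphere_support_integral \<longlongrightarrow> 0) (at_right 1)"
proof -
  note lim = delaunay_parameter_limits[OF ex]
  have ge1: "eventually (\<lambda>c :: real. c \<in> {1..}) (at_right 1)"
    by (auto simp: eventually_at_filter)
  have id: "((\<lambda>c. c) \<longlongrightarrow> (1 :: real)) (at_right 1)"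
    by (rule tendsto_ident_at)
  have pair: "((\<lambda>c. (delaunay_a c, delaunay_y c)) \<longlongrightarrow> (1, 1)) (at_right 1)"
    by (intro tendsto_Pair lim)
  have nodoid_integrand: "continuous_on ({1..} \<times> T) (\<lambda>(c :: real, s). cos s - (cos s)\<^sup>2 / sqrt (c\<^sup>2 - (sin s)\<^sup>2))" for T
  proof -
    have "continuous_on ({1..} \<times> T) (\<lambda>(c :: real, s). (cos s)\<^sup>2 / sqrt (c\<^sup>2 - (sin s)\<^sup>2))"
      using continuous_on_nodoid_quotient by (rule continuous_on_subset) auto
    then show ?thesis
      unfolding case_prod_unfold by (intro continuous_on_diff) (auto intro!: continuous_intros)
  qed
  have height: "((\<lambda>c. snd (nodoid c (delaunay_L c) t)) \<longlongrightarrow>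
      4 + integral {0..t} (\<lambda>s. cos s - (cos s)\<^sup>2 / sqrt (1\<^sup>2 - (sin s)\<^sup>2))) (at_right 1)" for t
    unfolding nodoid_def snd_conv
    by (intro tendsto_add lim tendsto_integral_parametric[OF nodoid_integrand id _ ge1]) simp
  have n1: "((\<lambda>c. snd (nodoid c (delaunay_L c) pi)) \<longlongrightarrow> 2) (at_right 1)"
    using height[of pi] unfolding integral_nodoid_height_1 by simp
  \<comment> \<open>The value of this limit is immaterial, as the height at 2 pi enters multiplied
    by (c - 1)^2.\<close>
  obtain G where n2: "((\<lambda>c. snd (nodoid c (delaunay_L c) (2 * pi))) \<longlongrightarrow> G) (at_right 1)"
    using height by blast
  have n3: "((\<lambda>c. integral {pi..2 * pi} (nodoid_slice c)) \<longlongrightarrow> - 16 / 3) (at_right 1)"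
    using tendsto_integral_parametric[OF continuous_on_nodoid_slice id _ ge1, of pi "2 * pi"]
    by (simp add: integral_nodoid_slice_1)
  \<comment> \<open>Written through \<open>fst\<close> and \<open>snd\<close> of a pair so that (a,
    y) is the single parameter of \<open>tendsto_integral_parametric\<close>.\<close>
  have "((\<lambda>c. integral {0..pi} (\<lambda>x. sqrt ((fst (delaunay_a c, delaunay_y c))\<^sup>2 -
        (snd (delaunay_a c, delaunay_y c))\<^sup>2 * (cos x)\<^sup>2))) \<longlongrightarrow>
      integral {0..pi} (\<lambda>x. sqrt ((fst (1, 1 :: real))\<^sup>2 - (snd (1 :: real, 1))\<^sup>2 * (cos x)\<^sup>2))) (at_right 1)"
    by (rule tendsto_integral_parametric[OF _ pair, where U = UNIV])
      (auto simp: case_prod_unfold intro!: continuous_intros)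
  then have u1: "((\<lambda>c. snd (unduloid (delaunay_a c) (delaunay_y c) pi)) \<longlongrightarrow> 2) (at_right 1)"
    unfolding fst_conv snd_conv integral_unduloid_height_1 by (simp add: unduloid_def)
  have u2: "((\<lambda>c. snd (unduloid (delaunay_a c) (delaunay_y c) 0)) \<longlongrightarrow> 0) (at_right 1)"
    by (simp add: unduloid_def)
  have "((\<lambda>c. integral {0..pi} (unduloid_arclength_slice (fst (delaunay_a c, delaunay_y c)) (snd (delaunay_a c, delaunay_y c)))) \<longlongrightarrow>
      integral {0..pi} (unduloid_arclength_slice (fst (1, 1 :: real)) (snd (1 :: real, 1)))) (at_right 1)"
    by (rule tendsto_integral_parametric[OF _ pair, where U = UNIV])
      (auto simp: case_prod_unfold unduloid_arclength_slice_def intro!: continuous_intros)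
  then have u3: "((\<lambda>c. integral {0..pi} (unduloid_arclength_slice (delaunay_a c) (delaunay_y c))) \<longlongrightarrow> 16 / 3) (at_right 1)"
    by (simp add: integral_unduloid_arclength_slice_1)
  \<comment> \<open>The four lines amount to 12, -4 + 8 = 4, 4 - 8 = -4 and -12: each cap and each
    arc cancels its partner.\<close>
  have "(delaunay_sphere_support_integral \<longlongrightarrow>
    2 * pi * (((1 + 1)\<^sup>2 * (4 / 2) / 2 + (1 + 1) ^ 3) +
      ((1 - 1)\<^sup>2 * G / 2 - (1 + 1)\<^sup>2 * 2 / 2 - 3 / 2 * (- 16 / 3)) +
      ((1 + 1)\<^sup>2 * 2 / 2 - (1 - 1)\<^sup>2 * 0 / 2 - 3 / 2 * (16 / 3)) -
      ((1 + 1)\<^sup>2 * (4 / 2) / 2 + (1 + 1) ^ 3))) (at_right 1)"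
    unfolding delaunay_sphere_support_integral_def[abs_def] Let_def
    by (intro tendsto_intros lim n1 n2 n3 u1 u2 u3) simp_all
  then show ?thesis by simp
qed

lemma isoperimetric_ratio_delaunay_sphere_limit:
  assumes ex: "eventually delaunay_torus_exists (at_right 1)"
  shows "((\<lambda>c. isoperimetric_ratio (delaunay_sphere c)) \<longlongrightarrow> \<infinity>) (at_right 1)"
  unfolding tendsto_PInfty
proof
  fix M :: real
  \<comment> \<open>Chosen so that \<open>e powr (2 / 3)\<close> is 1 / (|M| + 1). An area of at
    least 1 then pushes the ratio above \<open>M\<close> whenever the volume is positive.\<close>
  define e where "e = (1 / (\<bar>M\<bar> + 1)) powr (3 / 2)"
  have e: "e > 0" by (simp add: e_def)
  have "((\<lambda>c. \<bar>delaunay_sphere_support_integral c\<bar> / 3) \<longlongrightarrow> \<bar>0\<bar> / 3) (at_right 1)"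
    by (intro tendsto_intros delaunay_sphere_support_integral_limit ex) simp
  then have "eventually (\<lambda>c. \<bar>delaunay_sphere_support_integral c\<bar> / 3 < e) (at_right 1)"
    using e by (intro order_tendstoD(2)) auto
  with ex show "eventually (\<lambda>c. ereal M < isoperimetric_ratio (delaunay_sphere c)) (at_right 1)"
  proof eventually_elim
    case (elim c)
    let ?A = "surface_area (delaunay_sphere c)" and ?V = "surface_vol (delaunay_sphere c)"
    have "M < ?A / ?V powr (2 / 3)" if "?V > 0"
    proof -
      have "?V powr (2 / 3) \<le> e powr (2 / 3)"
        using elim that by (intro powr_mono2) (auto simp: surface_vol_delaunay_sphere)
      also have "\<dots> = 1 / (\<bar>M\<bar> + 1)"
        by (simp add: e_def powr_powr)
      finally have V: "?V powr (2 / 3) \<le> 1 / (\<bar>M\<bar> + 1)" .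
      have "1 \<le> 2 * pi * (c + 1)\<^sup>2"
      proof -
        have "1 * 1 \<le> (2 * pi) * (c + 1)\<^sup>2"
          using delaunayD(1)[OF elim(1)] pi_gt3 by (intro mult_mono one_le_power) auto
        then show ?thesis by simp
      qed
      then have A: "1 \<le> ?A"
        using surface_area_delaunay_sphere_ge[OF elim(1)] by linarith
      have "M < 1 / (1 / (\<bar>M\<bar> + 1))" by simp
      also have "\<dots> \<le> ?A / ?V powr (2 / 3)"
        using V A that by (intro frac_le) auto
      finally show ?thesis .
    qed
    then show ?case by (auto simp: isoperimetric_ratio_def)
  qed
qed

theorem theorem1p2:
  fixes \<gamma>\<^sub>0 :: real
  assumes "\<gamma>\<^sub>0 > 1"
    and "\<And>c. 1 < c \<Longrightarrow> c < \<gamma>\<^sub>0 \<Longrightarrow> delaunay_torus_exists c"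
  shows "(\<forall>c. 1 < c \<and> c < \<gamma>\<^sub>0 \<longrightarrow>
            willmore_energy (delaunay_sphere c) = 4 * pi + willmore_energy (delaunay_torus c) / 2) \<and>
         ((\<lambda>c. isoperimetric_ratio (delaunay_sphere c)) \<longlongrightarrow> \<infinity>) (at_right 1)"
proof (intro conjI allI impI)
  fix c assume "1 < c \<and> c < \<gamma>\<^sub>0"
  then show "willmore_energy (delaunay_sphere c) = 4 * pi + willmore_energy (delaunay_torus c) / 2"
    using assms(2) by (intro willmore_delaunay_sphere) auto
next
  have "eventually (\<lambda>c. c \<in> {1<..<\<gamma>\<^sub>0}) (at_right 1)"
    using assms(1) by (rule eventually_at_right_real)
  then have "eventually delaunay_torus_exists (at_right 1)"
    by eventually_elim (use assms(2) in auto)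
  then show "((\<lambda>c. isoperimetric_ratio (delaunay_sphere c)) \<longlongrightarrow> \<infinity>) (at_right 1)"
    by (rule isoperimetric_ratio_delaunay_sphere_limit)
qed

end
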